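(* Let $\Omega$ be a domain in $\mathbb{R}^{m+n}$, $m\geq n\geq 2$. Let $u:\Omega\rightarrow[-\infty,+\infty)$ be such that the following conditions are satisfied: (a) For each $y\in\mathbb{R}^n$ the function $\Omega(y)\ni x\mapsto u(x,y)\in[-\infty,+\infty)$ is subharmonic. (b) For each $x\in\mathbb{R}^m$ the function $\Omega(x)\ni y\mapsto u(x,y)\in[-\infty,+\infty)$ is subharmonic. (c) There is a strictly increasing surjection $\varphi:[0,+\infty)\rightarrow[0,+\infty)$ such that (c1) $\displaystyle\int_{1}^{+\infty}\frac{s^{(n-1)/(m-1)}}{\varphi(s)^{1/(m-1)}}\,ds<+\infty$, (c2) $\varphi(\log^+[(u^+)^r])\in\mathcal{L}^1_{\mathrm{loc}}(\Omega)$ for some $r>0$. Then $u$ is subharmonic in $\Omega$.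
   Context: Points of $\mathbb{R}^{m+n}$ are written $(x,y)$ with $x\in\mathbb{R}^m$, $y\in\mathbb{R}^n$. The sections of $\Omega$ are the open sets $\Omega(y)=\{x\in\mathbb{R}^m:(x,y)\in\Omega\}$ and $\Omega(x)=\{y\in\mathbb{R}^n:(x,y)\in\Omega\}$ (conditions on empty sections are void). $u^+=\max\{u,0\}$; $\log^+t=\max\{\log t,0\}$ for $t>0$ and $\log^+0=0$. $m_N$ is Lebesgue measure on $\mathbb{R}^N$ and $\nu_N=m_N(B^N(0,1))$. Let $D$ be an open set in $\mathbb{R}^N$, $N\geq 2$. An upper semicontinuous function $v:D\to[-\infty,+\infty)$ is subharmonic if for all closed balls $\overline{B^N(x,r)}\subset D$, $$v(x)\leq\frac{1}{\nu_N r^N}\int_{B^N(x,r)}v(y)\,dm_N(y).$$ The function $v\equiv-\infty$ is considered subharmonic. *)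

theory Defs
  imports "HOL-Analysis.Analysis"
begin

definition upper_semicontinuous_on :: "'a::topological_space set \<Rightarrow> ('a \<Rightarrow> ereal) \<Rightarrow> bool" where
  "upper_semicontinuous_on D v \<longleftrightarrow> (\<forall>a. openin (top_of_set D) {x \<in> D. v x < a})"

(* The integral of the positive part minus that of the negative part (e2ennreal sends negative
   values to 0). It is meaningful if at least one of the two is finite. This is so in the
   definition below: the closed ball is compact, so an upper semicontinuous function without
   the value \<infinity> is bounded above on it. *)
definition ereal_set_integral :: "'a::euclidean_space set \<Rightarrow> ('a \<Rightarrow> ereal) \<Rightarrow> ereal" where
  "ereal_set_integral A v =
     enn2ereal (\<integral>\<^sup>+y\<in>A. e2ennreal (v y) \<partial>lebesgue)
     - enn2ereal (\<integral>\<^sup>+y\<in>A. e2ennreal (- v y) \<partial>lebesgue)"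

(* The constant function -\<infinity> is subharmonic, and every function is subharmonic on {}. *)
definition subharmonic_on :: "'a::euclidean_space set \<Rightarrow> ('a \<Rightarrow> ereal) \<Rightarrow> bool" where
  "subharmonic_on D v \<longleftrightarrow>
     open D \<and> (\<forall>x\<in>D. v x < \<infinity>) \<and> upper_semicontinuous_on D v \<and>
     (\<forall>x r. r > 0 \<longrightarrow> cball x r \<subseteq> D \<longrightarrow>
        v x \<le> ereal_set_integral (ball x r) v
               / ereal (measure lebesgue (ball (0::'a) 1) * r ^ DIM('a)))"

definition log_plus :: "real \<Rightarrow> real" where
  "log_plus t = (if t > 0 then max (ln t) 0 else 0)"

definition locally_integrable_on :: "('a::euclidean_space \<Rightarrow> real) \<Rightarrow> 'a set \<Rightarrow> bool" where
  "locally_integrable_on f \<Omega> \<longleftrightarrow>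
     (\<forall>K. compact K \<longrightarrow> K \<subseteq> \<Omega> \<longrightarrow> set_integrable lebesgue K f)"

end

theory Submission
  imports Defs
begin

text \<open>
  A separately subharmonic function that is locally bounded above is subharmonic
  (\<open>separately_subharmonic_imp_subharmonic\<close>): Fatou's lemma gives joint upper semicontinuity, and
  Tonelli's theorem gives the mean value inequality over balls of the product space. It remains to
  derive local boundedness from (c).

  A growth condition bounds a subharmonic function locally by an argument of Domar
  (\<open>subharmonic_domar_bound\<close>). Unless it is of size about \<open>2^j\<close> on a fixed proportion of a ball, a
  subharmonic function with value \<open>2^j\<close> at the centre reaches \<open>2^(j+1)\<close> somewhere in that ball. If the
  sets where the function is large are small, the radii can be chosen with a small sum, and the
  points at which the values double stay in a compact set, contradicting boundedness there.

  Applied directly in dimension \<open>m + n\<close> this would need more growth of \<open>\<phi>\<close> than (c1) grants. Instead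
  the argument is used once in each factor (\<open>separately_subharmonic_locally_bounded\<close>). For almost
  every \<open>x\<close>, the \<open>n\<close>-dimensional argument on the slice over \<open>x\<close> turns a large value \<open>u(x, y)\<close> into a lower bound for
  \<open>G(x) = \<integral> \<phi>(log\<^sup>+ (u\<^sup>+)^r)(x, y) dy\<close> that does not depend on \<open>y\<close>. So \<open>G\<close>, which is integrable, controls
  all functions \<open>u(\<cdot>, y)\<close> at once, and the \<open>m\<close>-dimensional argument bounds them uniformly. The
  lower bound involves the tails of \<open>\<Sum> \<phi>(c j)^(-1/(n-1))\<close>, and a Hardy-type inequality
  (\<open>summable_powr_tails\<close>) for the exponent \<open>(n-1)/(m-1) \<le> 1\<close> shows that the second argument applies
  under (c1). This is where \<open>m \<ge> n\<close> is used.
\<close>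

section \<open>The mean value inequality for nonnegative functions\<close>

text \<open>
  The integral in the definition of a subharmonic function is a difference of two
  extended nonnegative integrals. Wherever \<open>v\<close> is bounded above by some \<open>M \<ge> 0\<close>, it is easier to
  work with the single nonnegative function \<open>M - v\<close>: the sub-mean-value inequality for \<open>v\<close> becomes a
  super-mean-value inequality for \<open>M - v\<close>, to which monotone estimates, Fatou's lemma and
  Tonelli's theorem apply without integrability side conditions, and the value \<open>-\<infinity>\<close> of \<open>v\<close> becomes
  the value \<open>\<infinity>\<close>.
\<close>

lemma e2ennreal_diff_split:
  assumes "v \<le> ereal M" "0 \<le> M"
  shows "e2ennreal (ereal M - v) + e2ennreal v = ennreal M + e2ennreal (- v)"
proof (cases v)
  case (real s)
  then show ?thesis
    using assms by (cases "s \<ge> 0") (auto simp: ennreal_neg simp flip: ennreal_plus)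
qed (use assms in \<open>auto simp: e2ennreal_neg\<close>)

lemma e2ennreal_diff_le_iff:
  assumes "c < M"
  shows "ennreal (M - c) \<le> e2ennreal (ereal M - v) \<longleftrightarrow> v \<le> ereal c"
  using assms by (cases v) (auto simp: e2ennreal_neg ennreal_le_iff2)

lemma upper_semicontinuous_on_open_iff:
  assumes "open D"
  shows "upper_semicontinuous_on D v \<longleftrightarrow> (\<forall>a. open {x\<in>D. v x < a})"
  using assms by (auto simp: upper_semicontinuous_on_def openin_open_eq)

lemma subharmonic_on_open_sublevel:
  "subharmonic_on D v \<Longrightarrow> open {x\<in>D. v x < a}"
  using upper_semicontinuous_on_open_iff[of D v] by (simp add: subharmonic_on_def)

lemma upper_semicontinuous_on_subset:
  assumes "upper_semicontinuous_on D v" "E \<subseteq> D"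
  shows "upper_semicontinuous_on E v"
  unfolding upper_semicontinuous_on_def
proof
  fix a
  obtain T where "open T" "{x \<in> D. v x < a} = D \<inter> T"
    using assms unfolding upper_semicontinuous_on_def openin_open by blast
  moreover from this have "{x \<in> E. v x < a} = E \<inter> T" using assms(2) by blast
  ultimately show "openin (top_of_set E) {x \<in> E. v x < a}" by (auto simp: openin_open)
qed

text \<open>
  Nothing is known about \<open>v\<close> outside \<open>D\<close>, so measurability can only be asserted after a
  modification there; with the value \<open>-\<infinity>\<close> the sublevel sets stay unions of an open and a closed set.
\<close>

lemma upper_semicontinuous_on_borel_measurable:
  fixes v :: "'a::euclidean_space \<Rightarrow> ereal"
  assumes "upper_semicontinuous_on D v" "open D"
  shows "(\<lambda>x. if x \<in> D then v x else -\<infinity>) \<in> borel_measurable borel"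
proof (rule borel_measurableI_less)
  fix a :: ereal
  have "{x. (if x \<in> D then v x else -\<infinity>) < a} = {x\<in>D. v x < a} \<union> (if a = -\<infinity> then {} else - D)"
    by auto
  moreover have "open {x\<in>D. v x < a}"
    using assms upper_semicontinuous_on_open_iff by blast
  ultimately show "{x \<in> space borel. (if x \<in> D then v x else -\<infinity>) < a} \<in> sets borel"
    using assms(2) by auto
qed

lemma upper_semicontinuous_on_compact_bounded:
  fixes v :: "'a::euclidean_space \<Rightarrow> ereal"
  assumes "upper_semicontinuous_on K v" "compact K" "\<And>x. x \<in> K \<Longrightarrow> v x < \<infinity>"
  obtains M where "0 \<le> M" "\<And>x. x \<in> K \<Longrightarrow> v x \<le> ereal M"
proof -
  have "\<forall>k::nat. \<exists>T. open T \<and> {x\<in>K. v x < ereal k} = K \<inter> T"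
    using assms(1) by (auto simp: upper_semicontinuous_on_def openin_open)
  then obtain T where T: "\<And>k::nat. open (T k)" "\<And>k. {x\<in>K. v x < ereal k} = K \<inter> T k"
    by metis
  have "K \<subseteq> \<Union>(range T)"
  proof
    fix x assume x: "x \<in> K"
    with assms(3) have "v x \<noteq> \<infinity>" by force
    then obtain k :: nat where "v x < ereal k"
      using less_PInf_Ex_of_nat by force
    with x T(2)[of k] show "x \<in> \<Union>(range T)" by auto
  qed
  with \<open>compact K\<close> T(1) obtain C where C: "C \<subseteq> range T" "finite C" "K \<subseteq> \<Union>C"
    by (metis (no_types, lifting) compactE rangeE)
  then obtain I where I: "finite I" "C = T ` I"
    by (meson finite_subset_image)
  define M where "M = Max (insert 0 I)"
  have "v x \<le> ereal M" if xK: "x \<in> K" for x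
  proof -
    obtain k where k: "k \<in> I" "x \<in> T k" using C(3) I(2) xK by blast
    with T(2)[of k] xK have "v x < ereal k" by blast
    moreover have "k \<le> M" using I k by (simp add: M_def)
    ultimately show ?thesis by (meson ereal_less_eq(3) less_imp_le of_nat_mono order_trans)
  qed
  then show thesis using that[of "real M"] by auto
qed

lemma borel_measurable_e2ennreal_diff:
  fixes v :: "'a::euclidean_space \<Rightarrow> ereal"
  assumes "subharmonic_on D v" "B \<subseteq> D" "B \<in> sets borel"
  shows "(\<lambda>x. e2ennreal (ereal M - v x) * indicator B x) \<in> borel_measurable borel"
proof -
  have "(\<lambda>x. if x \<in> D then v x else -\<infinity>) \<in> borel_measurable borel"
    using assms(1) by (intro upper_semicontinuous_on_borel_measurable) (auto simp: subharmonic_on_def)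
  then have "(\<lambda>x. e2ennreal (ereal M - (if x \<in> D then v x else -\<infinity>)) * indicator B x)
      \<in> borel_measurable borel"
    using assms(3)
    by (intro borel_measurable_times_ennreal borel_measurable_indicator) (auto intro: measurable_e2ennreal)
  moreover have "(\<lambda>x. e2ennreal (ereal M - (if x \<in> D then v x else -\<infinity>)) * indicator B x)
      = (\<lambda>x. e2ennreal (ereal M - v x) * indicator B x)"
    using assms(2) by (intro ext) (auto simp: indicator_def)
  ultimately show ?thesis by simp
qed

lemma measure_unit_ball_scale:
  assumes "r \<ge> 0"
  shows "measure lebesgue (ball (0::'a::euclidean_space) 1) * r ^ DIM('a) = measure lborel (ball (x::'a) r)"
  using assms by (simp add: content_ball)

text \<open>
  With \<open>W\<close>, \<open>P\<close>, \<open>Q\<close> the integrals of \<open>M - v\<close> and of the positive and negative parts of \<open>v\<close> over a ball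
  of volume \<open>V\<close>, additivity gives \<open>W + P = M V + Q\<close>, and \<open>P \<le> M V\<close> is finite. So \<open>W\<close> and \<open>Q\<close> are finite
  or infinite together, and in the finite case both inequalities say \<open>V v(x) \<le> P - Q\<close>.
\<close>

lemma submean_iff:
  fixes v :: "'a::euclidean_space \<Rightarrow> ereal"
  assumes usc: "upper_semicontinuous_on (ball x r) v" and "r > 0" "0 \<le> M"
    and le: "\<And>y. y \<in> ball x r \<Longrightarrow> v y \<le> ereal M"
  shows "v x \<le> ereal_set_integral (ball x r) v / ereal (measure lebesgue (ball (0::'a) 1) * r ^ DIM('a))
     \<longleftrightarrow> (\<integral>\<^sup>+y\<in>ball x r. e2ennreal (ereal M - v y) \<partial>lborel)
          \<le> emeasure lborel (ball x r) * e2ennreal (ereal M - v x)"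
proof -
  define f where "f y = (if y \<in> ball x r then v y else -\<infinity>)" for y
  have [measurable]: "f \<in> borel_measurable borel"
    unfolding f_def using upper_semicontinuous_on_borel_measurable[OF usc] by simp
  have [measurable]: "ball x r \<in> sets borel" by simp
  have "(\<lambda>y. e2ennreal (ereal M - f y)) \<in> borel_measurable borel"
    "(\<lambda>y. e2ennreal (f y)) \<in> borel_measurable borel"
    "(\<lambda>y. e2ennreal (- f y)) \<in> borel_measurable borel"
    by measurable
  then have [simp]: "(\<lambda>y. e2ennreal (ereal M - f y) * indicator (ball x r) y) \<in> borel_measurable borel"
    "(\<lambda>y. e2ennreal (f y) * indicator (ball x r) y) \<in> borel_measurable borel"
    "(\<lambda>y. e2ennreal (- f y) * indicator (ball x r) y) \<in> borel_measurable borel"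
    "(\<lambda>y. ennreal M * indicator (ball x r) y) \<in> borel_measurable borel"
    by (auto intro!: borel_measurable_times_ennreal borel_measurable_indicator)
  define V where "V = measure lborel (ball x r)"
  have V: "V > 0" "emeasure lborel (ball x r) = ennreal V"
    using \<open>r > 0\<close> by (auto simp: V_def emeasure_ball content_ball)
  define P where "P = (\<integral>\<^sup>+y\<in>ball x r. e2ennreal (f y) \<partial>lborel)"
  define Q where "Q = (\<integral>\<^sup>+y\<in>ball x r. e2ennreal (- f y) \<partial>lborel)"
  define W where "W = (\<integral>\<^sup>+y\<in>ball x r. e2ennreal (ereal M - f y) \<partial>lborel)"
  have "W + P = (\<integral>\<^sup>+y\<in>ball x r. (e2ennreal (ereal M - f y) + e2ennreal (f y)) \<partial>lborel)"
    unfolding W_def P_def by (subst nn_integral_add[symmetric]) (simp_all add: distrib_right)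
  also have "\<dots> = (\<integral>\<^sup>+y\<in>ball x r. (ennreal M + e2ennreal (- f y)) \<partial>lborel)"
    by (intro nn_integral_cong)
       (use le \<open>0 \<le> M\<close> in \<open>auto simp: f_def indicator_def intro!: e2ennreal_diff_split\<close>)
  also have "\<dots> = (\<integral>\<^sup>+y\<in>ball x r. ennreal M \<partial>lborel) + Q"
    unfolding Q_def by (subst nn_integral_add[symmetric]) (simp_all add: distrib_right)
  also have "(\<integral>\<^sup>+y\<in>ball x r. ennreal M \<partial>lborel) = ennreal (M * V)"
    using V \<open>0 \<le> M\<close> by (simp add: nn_integral_cmult_indicator ennreal_mult)
  finally have sum: "W + P = ennreal (M * V) + Q" .
  have "P \<le> (\<integral>\<^sup>+y\<in>ball x r. ennreal M \<partial>lborel)"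
    unfolding P_def
    by (intro nn_integral_mono)
       (use le e2ennreal_mono in \<open>fastforce simp: f_def indicator_def\<close>)
  also have "\<dots> = ennreal (M * V)"
    using V \<open>0 \<le> M\<close> by (simp add: nn_integral_cmult_indicator ennreal_mult)
  finally obtain p where p: "P = ennreal p" "0 \<le> p"
    by (cases P) (auto simp: top_unique)
  have cong: "(\<integral>\<^sup>+y\<in>ball x r. g (v y) \<partial>lborel) = (\<integral>\<^sup>+y\<in>ball x r. g (f y) \<partial>lborel)" for g
    by (intro nn_integral_cong) (auto simp: f_def indicator_def)
  have int: "ereal_set_integral (ball x r) v = ereal p - enn2ereal Q"
    unfolding ereal_set_integral_def nn_integral_completion
    using cong[of e2ennreal] cong[of "\<lambda>t. e2ennreal (- t)"] p by (simp add: P_def Q_def)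
  have vx: "v x \<le> ereal M" using le \<open>r > 0\<close> by simp
  have "v x \<le> (ereal p - enn2ereal Q) / ereal V \<longleftrightarrow> W \<le> ennreal V * e2ennreal (ereal M - v x)"
  proof (cases Q)
    case top
    then have "W = top" using sum p by (simp add: ennreal_add_eq_top)
    then show ?thesis
      using top V vx by (cases "v x") (auto simp: ennreal_mult_eq_top_iff top_unique ennreal_top_mult ennreal_mult_top)
  next
    case (real q)
    then obtain w where w: "W = ennreal w" "0 \<le> w"
      using sum p \<open>0 \<le> M\<close> V by (cases W) (auto simp flip: ennreal_plus)
    have eq: "w + p = M * V + q"
      using sum p real w \<open>0 \<le> M\<close> V by (simp flip: ennreal_plus)
    show ?thesis
    proof (cases "v x")
      case (real s)
      have "s \<le> (p - q) / V \<longleftrightarrow> w \<le> V * (M - s)"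
        using V eq by (simp add: field_simps) argo
      then show ?thesis
        using real \<open>Q = ennreal q\<close> \<open>0 \<le> q\<close> w vx V
        by (simp add: ennreal_mult[symmetric] enn2ereal_ennreal)
    qed (use vx V in \<open>auto simp: ennreal_mult_top\<close>)
  qed
  then show ?thesis
    unfolding int measure_unit_ball_scale[OF less_imp_le[OF \<open>r > 0\<close>], of x]
    using cong[of "\<lambda>t. e2ennreal (ereal M - t)"] V by (simp add: V_def W_def)
qed

lemma subharmonic_on_submean:
  fixes v :: "'a::euclidean_space \<Rightarrow> ereal"
  assumes "subharmonic_on D v" "cball x r \<subseteq> D" "r > 0" "0 \<le> M"
    and "\<And>y. y \<in> ball x r \<Longrightarrow> v y \<le> ereal M"
  shows "(\<integral>\<^sup>+y\<in>ball x r. e2ennreal (ereal M - v y) \<partial>lborel)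
          \<le> emeasure lborel (ball x r) * e2ennreal (ereal M - v x)"
proof (rule iffD1[OF submean_iff])
  show "upper_semicontinuous_on (ball x r) v"
    using assms ball_subset_cball unfolding subharmonic_on_def
    by (metis upper_semicontinuous_on_subset)
qed (use assms in \<open>auto simp: subharmonic_on_def\<close>)

section \<open>Locally bounded separately subharmonic functions\<close>

lemma open_contains_prod_cball:
  assumes "open W" "(x0, y0) \<in> W"
  obtains r where "r > 0" "cball x0 r \<times> cball y0 r \<subseteq> W"
proof -
  obtain A B where AB: "open A" "open B" "x0 \<in> A" "y0 \<in> B" "A \<times> B \<subseteq> W"
    using assms by (metis open_prod_elim mem_Sigma_iff)
  obtain r1 r2 where "r1 > 0" "cball x0 r1 \<subseteq> A" "r2 > 0" "cball y0 r2 \<subseteq> B"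
    using AB by (meson open_contains_cball)
  moreover have "cball x0 (min r1 r2) \<subseteq> cball x0 r1" "cball y0 (min r1 r2) \<subseteq> cball y0 r2" by auto
  ultimately show thesis using AB(5) that[of "min r1 r2"] by fastforce
qed

text \<open>
  Suppose \<open>u \<ge> c\<close> along a sequence \<open>(x\<^sub>i, y\<^sub>i)\<close> tending to \<open>(x\<^sub>0, y\<^sub>0)\<close>, while \<open>u(x\<^sub>0, y\<^sub>0) < d < c\<close>.
  Subharmonicity in \<open>x\<close> bounds the integral of \<open>M - u(\<cdot>, y\<^sub>i)\<close> over \<open>B(x\<^sub>i, \<rho>)\<close> by \<open>(M - c) V\<close>, where \<open>V\<close> is
  the volume of the ball. For every fixed \<open>x\<close> the function \<open>M - u(x, \<cdot>)\<close> is lower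
  semicontinuous, so Fatou's lemma passes to the limit: the integral of \<open>M - u(\<cdot>, y\<^sub>0)\<close> over
  \<open>B(x\<^sub>0, \<rho>)\<close> is also at most \<open>(M - c) V\<close>. But \<open>u(\<cdot>, y\<^sub>0) < d\<close> on this ball if \<open>\<rho>\<close> is small. All
  integrals are over slices of \<open>u\<close>, which are measurable by semicontinuity in each variable.
\<close>

lemma separately_subharmonic_imp_upper_semicontinuous:
  fixes u :: "'a::euclidean_space \<times> 'b::euclidean_space \<Rightarrow> ereal"
  assumes "open \<Omega>"
    and a: "\<forall>y. subharmonic_on {x. (x, y) \<in> \<Omega>} (\<lambda>x. u (x, y))"
    and b: "\<forall>x. subharmonic_on {y. (x, y) \<in> \<Omega>} (\<lambda>y. u (x, y))"
    and bdd: "\<And>z. z \<in> \<Omega> \<Longrightarrow> \<exists>W M. open W \<and> z \<in> W \<and> W \<subseteq> \<Omega> \<and> (\<forall>w\<in>W. u w \<le> ereal M)"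
  shows "upper_semicontinuous_on \<Omega> u"
proof -
  have "\<exists>T. open T \<and> z \<in> T \<and> T \<subseteq> {z\<in>\<Omega>. u z < c}" if z: "z \<in> {z\<in>\<Omega>. u z < c}" for c z
  proof (rule ccontr)
    assume contr: "\<not> ?thesis"
    obtain x0 y0 where xy: "z = (x0, y0)" by (cases z)
    obtain W M' where W: "open W" "(x0, y0) \<in> W" "W \<subseteq> \<Omega>" "\<And>w. w \<in> W \<Longrightarrow> u w \<le> ereal M'"
      using bdd[of z] z xy by auto
    define M where "M = max 0 M'"
    have M: "0 \<le> M" "\<And>w. w \<in> W \<Longrightarrow> u w \<le> ereal M"
    proof -
      show "u w \<le> ereal M" if "w \<in> W" for w
        using W(4)[OF that] by (rule order_trans) (simp add: M_def)
    qed (simp add: M_def)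
    obtain r where r: "r > 0" "cball x0 r \<times> cball y0 r \<subseteq> W"
      using open_contains_prod_cball[OF W(1,2)] .
    have cM: "c \<le> ereal M"
    proof (rule ccontr)
      assume "\<not> c \<le> ereal M"
      then have "W \<subseteq> {z\<in>\<Omega>. u z < c}" using M(2) W(3) by fastforce
      with W(1,2) contr xy show False by blast
    qed
    have uz: "u (x0, y0) < c" using z xy by simp
    then obtain d where d: "u (x0, y0) < ereal d" "ereal d < c"
      using ereal_dense2 by blast
    from d cM obtain c' where c: "c = ereal c'" "d < c'" "c' \<le> M"
      by (cases c) auto
    \<comment> \<open>points tending to \<open>z\<close> at which \<open>u \<ge> c\<close>\<close>
    have "\<exists>p. p \<in> cball x0 r \<times> cball y0 r \<and> dist p (x0, y0) < inverse (Suc i) \<and> c \<le> u p" for i :: nat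
    proof -
      have "open (ball (x0, y0) (inverse (Suc i)) \<inter> (ball x0 r \<times> ball y0 r))"
        by (intro open_Int open_Times) auto
      moreover have "(x0, y0) \<in> ball (x0, y0) (inverse (Suc i)) \<inter> (ball x0 r \<times> ball y0 r)"
        using r by simp
      ultimately obtain p where "p \<in> ball (x0, y0) (inverse (Suc i)) \<inter> (ball x0 r \<times> ball y0 r)"
        "p \<notin> {z\<in>\<Omega>. u z < c}"
        using contr xy by blast
      moreover from this have "p \<in> cball x0 r \<times> cball y0 r" by auto
      ultimately show ?thesis
        using r(2) W(3) by (intro exI[of _ p]) (auto simp: dist_commute)
    qed
    then obtain p where p: "\<And>i::nat. p i \<in> cball x0 r \<times> cball y0 r"
        "\<And>i. dist (p i) (x0, y0) < inverse (Suc i)" "\<And>i. c \<le> u (p i)"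
      by metis
    have lim: "p \<longlonglongrightarrow> (x0, y0)"
      by (rule iffD2[OF tendsto_dist_iff], rule tendsto_sandwich[OF _ _ tendsto_const LIMSEQ_inverse_real_of_nat])
         (use p(2) in \<open>auto intro!: always_eventually less_imp_le\<close>)
    define xs ys where "xs i = fst (p i)" and "ys i = snd (p i)" for i
    have xs: "xs \<longlonglongrightarrow> x0" and ys: "ys \<longlonglongrightarrow> y0"
      using tendsto_fst[OF lim] tendsto_snd[OF lim] by (simp_all add: xs_def[abs_def] ys_def[abs_def])
    have "open {x\<in>{x. (x, y0) \<in> \<Omega>}. u (x, y0) < ereal d}"
      using a by (intro subharmonic_on_open_sublevel) simp
    moreover have "x0 \<in> {x\<in>{x. (x, y0) \<in> \<Omega>}. u (x, y0) < ereal d}"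
      using d z xy by simp
    ultimately obtain s where s: "s > 0" "cball x0 s \<subseteq> {x\<in>{x. (x, y0) \<in> \<Omega>}. u (x, y0) < ereal d}"
      by (meson open_contains_cball)
    define \<rho> where "\<rho> = min s (r / 2)"
    have \<rho>: "\<rho> > 0" "\<rho> \<le> s" "\<rho> \<le> r / 2" using s r by (auto simp: \<rho>_def)
    define g where "g y x = e2ennreal (ereal M - u (x, y))" for x y
    define w where "w i x = g (ys i) x * indicator (ball (xs i) \<rho>) x" for i x
    define V where "V = measure lborel (ball x0 \<rho>)"
    have V: "V > 0" "emeasure lborel (ball x \<rho>) = ennreal V" for x :: 'a
      using \<rho> by (auto simp: V_def emeasure_ball content_ball)
    \<comment> \<open>after dropping \<open>k\<close> terms all balls \<open>B(x\<^sub>i, \<rho>)\<close> lie where \<open>u \<le> M\<close>\<close>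
    have ev: "\<forall>\<^sub>F i in sequentially. dist (xs i) x0 < r / 2"
      by (rule tendstoD[OF xs]) (use r in simp)
    then obtain k where k: "\<And>i. i \<ge> k \<Longrightarrow> dist (xs i) x0 < r / 2"
      by (auto simp: eventually_sequentially)
    have sub: "cball (xs (i + k)) \<rho> \<subseteq> cball x0 r" for i
    proof
      fix x assume "x \<in> cball (xs (i + k)) \<rho>"
      then show "x \<in> cball x0 r"
        using k[of "i + k"] \<rho>(3) dist_triangle[of x0 x "xs (i + k)"]
        by (simp add: dist_commute)
    qed
    have ysr: "ys i \<in> cball y0 r" for i
      using p(1)[of i] by (auto simp: ys_def mem_Times_iff)
    have upper: "(\<integral>\<^sup>+x. w (i + k) x \<partial>lborel) \<le> ennreal V * ennreal (M - c')" for i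
    proof -
      have "(\<integral>\<^sup>+x. w (i + k) x \<partial>lborel) \<le> emeasure lborel (ball (xs (i + k)) \<rho>) * g (ys (i + k)) (xs (i + k))"
        unfolding w_def g_def
      proof (rule subharmonic_on_submean[OF a[rule_format, of "ys (i + k)"]])
        show "cball (xs (i + k)) \<rho> \<subseteq> {x. (x, ys (i + k)) \<in> \<Omega>}"
          using sub[of i] ysr[of "i + k"] r(2) W(3) by blast
        show "u (x, ys (i + k)) \<le> ereal M" if "x \<in> ball (xs (i + k)) \<rho>" for x
        proof (rule M(2))
          have "x \<in> cball x0 r" using that sub[of i] by force
          then show "(x, ys (i + k)) \<in> W" using ysr r(2) by blast
        qed
      qed (use \<rho> M in auto)
      also have "g (ys (i + k)) (xs (i + k)) \<le> ennreal (M - c')"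
      proof -
        have "ereal M - u (p (i + k)) \<le> ereal (M - c')"
          using p(3)[of "i + k"] c by (cases "u (p (i + k))") auto
        then show ?thesis
          unfolding g_def xs_def ys_def using e2ennreal_mono by fastforce
      qed
      finally show ?thesis by (simp add: V mult_left_mono)
    qed
    have meas: "w (i + k) \<in> borel_measurable lborel" for i
    proof -
      have "ball (xs (i + k)) \<rho> \<subseteq> {x. (x, ys (i + k)) \<in> \<Omega>}"
        using sub[of i] ysr[of "i + k"] r(2) W(3) ball_subset_cball by blast
      from borel_measurable_e2ennreal_diff[OF a[rule_format] this, of M]
      show ?thesis by (simp add: w_def[abs_def] g_def[abs_def])
    qed
    have fatou: "(\<integral>\<^sup>+x. liminf (\<lambda>i. w (i + k) x) \<partial>lborel) \<le> ennreal V * ennreal (M - c')"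
    proof -
      have "(\<integral>\<^sup>+x. liminf (\<lambda>i. w (i + k) x) \<partial>lborel) \<le> liminf (\<lambda>i. \<integral>\<^sup>+x. w (i + k) x \<partial>lborel)"
        by (rule nn_integral_liminf) (rule meas)
      also have "\<dots> \<le> liminf (\<lambda>i::nat. ennreal V * ennreal (M - c'))"
        by (rule Liminf_mono) (use upper in \<open>auto intro: always_eventually\<close>)
      finally show ?thesis by (simp add: Liminf_const)
    qed
    have lower: "ennreal (M - d) * indicator (ball x0 \<rho>) x \<le> liminf (\<lambda>i. w (i + k) x)" for x
    proof (cases "x \<in> ball x0 \<rho>")
      case True
      have "open {y\<in>{y. (x, y) \<in> \<Omega>}. u (x, y) < ereal d}"
        using b by (intro subharmonic_on_open_sublevel) simp
      moreover have "x \<in> cball x0 s" using True \<rho>(2) by simp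
      then have "y0 \<in> {y\<in>{y. (x, y) \<in> \<Omega>}. u (x, y) < ereal d}"
        using s(2) by blast
      ultimately have e1: "\<forall>\<^sub>F i in sequentially. ys i \<in> {y\<in>{y. (x, y) \<in> \<Omega>}. u (x, y) < ereal d}"
        using ys topological_tendstoD by blast
      have "\<forall>\<^sub>F i in sequentially. dist (xs i) x0 < \<rho> - dist x0 x"
        by (rule tendstoD[OF xs]) (use True in simp)
      then have e2: "\<forall>\<^sub>F i in sequentially. x \<in> ball (xs i) \<rho>"
      proof eventually_elim
        case (elim i)
        then show ?case using dist_triangle[of "xs i" x x0] by simp
      qed
      from e1 e2 have "\<forall>\<^sub>F i in sequentially. ennreal (M - d) \<le> w i x"
      proof eventually_elim
        case (elim i)
        then show ?case
          using e2ennreal_diff_le_iff[of d M "u (x, ys i)"] c by (simp add: w_def g_def less_imp_le)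
      qed
      then have "\<forall>\<^sub>F i in sequentially. ennreal (M - d) \<le> w (i + k) x"
        using eventually_sequentially_seg[of "\<lambda>i. ennreal (M - d) \<le> w i x" k] by simp
      then show ?thesis using True by (simp add: Liminf_bounded)
    qed auto
    have "ennreal (M - d) * ennreal V = (\<integral>\<^sup>+x. ennreal (M - d) * indicator (ball x0 \<rho>) x \<partial>lborel)"
      by (simp add: nn_integral_cmult_indicator V)
    also have "\<dots> \<le> (\<integral>\<^sup>+x. liminf (\<lambda>i. w (i + k) x) \<partial>lborel)"
      by (rule nn_integral_mono) (rule lower)
    also note fatou
    finally have "(M - d) * V \<le> V * (M - c')"
      using V c by (simp flip: ennreal_mult)
    then show False using V c by (simp add: mult.commute)
  qed
  then show ?thesis
    unfolding upper_semicontinuous_on_open_iff[OF assms(1)]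
    by (subst open_subopen) blast
qed

lemma section_ball_fst:
  "{x. (x, y) \<in> ball (x0, y0) R} =
     (if dist y0 y < R then ball x0 (sqrt (R\<^sup>2 - (dist y0 y)\<^sup>2)) else {})"
proof -
  have eq: "sqrt ((dist x0 x)\<^sup>2 + (dist y0 y)\<^sup>2) < R \<longleftrightarrow> dist y0 y < R \<and> dist x0 x < sqrt (R\<^sup>2 - (dist y0 y)\<^sup>2)" for x
  proof (cases "dist y0 y < R")
    case True
    then have "R > 0" using zero_le_dist[of y0 y] by linarith
    then have "sqrt ((dist x0 x)\<^sup>2 + (dist y0 y)\<^sup>2) < R \<longleftrightarrow> (dist x0 x)\<^sup>2 + (dist y0 y)\<^sup>2 < R\<^sup>2"
      by (metis abs_of_pos real_sqrt_abs real_sqrt_less_iff)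
    also have "\<dots> \<longleftrightarrow> (dist x0 x)\<^sup>2 < R\<^sup>2 - (dist y0 y)\<^sup>2" by linarith
    also have "\<dots> \<longleftrightarrow> dist x0 x < sqrt (R\<^sup>2 - (dist y0 y)\<^sup>2)"
      by (metis abs_of_nonneg real_sqrt_abs real_sqrt_less_iff zero_le_dist)
    finally show ?thesis using True by simp
  next
    case False
    have "dist y0 y \<le> sqrt ((dist x0 x)\<^sup>2 + (dist y0 y)\<^sup>2)"
      by (rule real_sqrt_sum_squares_ge2)
    with False show ?thesis by linarith
  qed
  show ?thesis
    unfolding set_eq_iff mem_Collect_eq mem_ball dist_prod_def fst_conv snd_conv eq by simp
qed

lemma section_ball_snd:
  "{y. (x, y) \<in> ball (x0, y0) R} =
     (if dist x0 x < R then ball y0 (sqrt (R\<^sup>2 - (dist x0 x)\<^sup>2)) else {})"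
  using section_ball_fst[of x y0 x0 R] by (simp add: dist_prod_def add.commute)

lemma cball_section_fst_subset:
  assumes "dist y0 y < R"
  shows "cball x0 (sqrt (R\<^sup>2 - (dist y0 y)\<^sup>2)) \<times> {y} \<subseteq> cball (x0, y0) R"
proof clarify
  fix x assume "x \<in> cball x0 (sqrt (R\<^sup>2 - (dist y0 y)\<^sup>2))"
  then have "(dist x0 x)\<^sup>2 \<le> (sqrt (R\<^sup>2 - (dist y0 y)\<^sup>2))\<^sup>2"
    by (intro power_mono) auto
  also have "\<dots> = R\<^sup>2 - (dist y0 y)\<^sup>2"
    using assms by (simp add: power_mono)
  finally have "sqrt ((dist x0 x)\<^sup>2 + (dist y0 y)\<^sup>2) \<le> sqrt (R\<^sup>2)"
    by (intro real_sqrt_le_mono) linarith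
  then show "(x, y) \<in> cball (x0, y0) R"
    using assms zero_le_dist[of y0 y] by (simp add: dist_prod_def)
qed

lemma sqrt_diff_squares_pos: "0 \<le> d \<Longrightarrow> d < R \<Longrightarrow> 0 < sqrt (R\<^sup>2 - d\<^sup>2)"
  by (simp add: power_strict_mono)

text \<open>
  The inequality over a ball of the product space follows from Tonelli's theorem, used
  twice. All sections of a ball are balls with the same centre in the factor, so the
  inequality in \<open>x\<close> replaces \<open>M - u(x, y)\<close> by \<open>M - u(x\<^sub>0, y)\<close> under the integral. The new integrand
  does not depend on \<open>x\<close>; integrating in the other order, the inequality in \<open>y\<close> along the single
  slice through \<open>x\<^sub>0\<close> replaces it by the constant \<open>M - u(x\<^sub>0, y\<^sub>0)\<close>.
\<close>

lemma separately_subharmonic_imp_subharmonic: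
  fixes u :: "'a::euclidean_space \<times> 'b::euclidean_space \<Rightarrow> ereal"
  assumes "open \<Omega>" and fin: "\<And>z. z \<in> \<Omega> \<Longrightarrow> u z < \<infinity>"
    and a: "\<forall>y. subharmonic_on {x. (x, y) \<in> \<Omega>} (\<lambda>x. u (x, y))"
    and b: "\<forall>x. subharmonic_on {y. (x, y) \<in> \<Omega>} (\<lambda>y. u (x, y))"
    and bdd: "\<And>z. z \<in> \<Omega> \<Longrightarrow> \<exists>W M. open W \<and> z \<in> W \<and> W \<subseteq> \<Omega> \<and> (\<forall>w\<in>W. u w \<le> ereal M)"
  shows "subharmonic_on \<Omega> u"
  unfolding subharmonic_on_def
proof (intro conjI allI impI ballI)
  show usc: "upper_semicontinuous_on \<Omega> u"
    by (rule separately_subharmonic_imp_upper_semicontinuous[OF \<open>open \<Omega>\<close> a b bdd])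
  fix z :: "'a \<times> 'b" and R :: real
  assume R: "R > 0" "cball z R \<subseteq> \<Omega>"
  obtain x0 y0 where z: "z = (x0, y0)" by (cases z)
  obtain M where M: "0 \<le> M" "\<And>w. w \<in> cball z R \<Longrightarrow> u w \<le> ereal M"
    using upper_semicontinuous_on_compact_bounded[OF upper_semicontinuous_on_subset[OF usc R(2)]] R(2) fin
    by (metis compact_cball subsetD)
  let ?B = "ball z R"
  have B: "?B \<subseteq> cball z R" by auto
  define w where "w p = e2ennreal (ereal M - (if p \<in> ?B then u p else -\<infinity>))" for p
  have "(\<lambda>p. if p \<in> ?B then u p else -\<infinity>) \<in> borel_measurable borel"
    using R(2) B by (intro upper_semicontinuous_on_borel_measurable upper_semicontinuous_on_subset[OF usc]) auto
  then have [measurable]: "w \<in> borel_measurable (lborel \<Otimes>\<^sub>M lborel)"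
    unfolding w_def lborel_prod by simp
  have [measurable]: "?B \<in> sets (lborel \<Otimes>\<^sub>M lborel)"
    unfolding lborel_prod by simp
  have sec1: "(\<integral>\<^sup>+x. w (x, y) * indicator ?B (x, y) \<partial>lborel) \<le> (\<integral>\<^sup>+x. w (x0, y) * indicator ?B (x, y) \<partial>lborel)" for y
  proof (cases "dist y0 y < R")
    case True
    let ?s = "sqrt (R\<^sup>2 - (dist y0 y)\<^sup>2)"
    have s: "?s > 0" using True by (intro sqrt_diff_squares_pos) auto
    have ind: "indicator ?B (x, y) = (indicator (ball x0 ?s) x :: ennreal)" for x
      using section_ball_fst[of y x0 y0 R] True z by (auto simp: indicator_def set_eq_iff)
    have mem: "(x, y) \<in> ?B \<longleftrightarrow> x \<in> ball x0 ?s" for x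
      using section_ball_fst[of y x0 y0 R] True z by (auto simp: set_eq_iff)
    have sub: "cball x0 ?s \<times> {y} \<subseteq> cball z R"
      using cball_section_fst_subset[OF True, of x0] z by simp
    have "(\<integral>\<^sup>+x. w (x, y) * indicator ?B (x, y) \<partial>lborel)
        = (\<integral>\<^sup>+x\<in>ball x0 ?s. e2ennreal (ereal M - u (x, y)) \<partial>lborel)"
      by (intro nn_integral_cong) (simp add: ind w_def mem indicator_def del: mem_ball)
    also have "\<dots> \<le> emeasure lborel (ball x0 ?s) * e2ennreal (ereal M - u (x0, y))"
      by (rule subharmonic_on_submean[OF a[rule_format, of y]])
         (use s sub R(2) M in \<open>auto 0 4 intro!: M(2)\<close>)
    also have "\<dots> = (\<integral>\<^sup>+x. w (x0, y) * indicator ?B (x, y) \<partial>lborel)"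
      using s mem[of x0] by (simp add: ind nn_integral_cmult_indicator mult.commute w_def)
    finally show ?thesis .
  next
    case False
    then have "(x, y) \<notin> ?B" for x
      using section_ball_fst[of y x0 y0 R] z by auto
    then show ?thesis by simp
  qed
  have sec2: "(\<integral>\<^sup>+y. w (x0, y) * indicator ?B (x, y) \<partial>lborel) \<le> (\<integral>\<^sup>+y. w z * indicator ?B (x, y) \<partial>lborel)" for x
  proof (cases "dist x0 x < R")
    case True
    let ?s = "sqrt (R\<^sup>2 - (dist x0 x)\<^sup>2)"
    have s: "?s > 0" using True by (intro sqrt_diff_squares_pos) auto
    have mem: "(x, y) \<in> ?B \<longleftrightarrow> y \<in> ball y0 ?s" for y
      using section_ball_snd[of x x0 y0 R] True z by (auto simp: set_eq_iff)
    then have ind: "indicator ?B (x, y) = (indicator (ball y0 ?s) y :: ennreal)" for y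
      by (auto simp: indicator_def)
    \<comment> \<open>the section over \<open>x\<close>, moved to \<open>{x\<^sub>0}\<close>, still lies in the ball\<close>
    have "?s \<le> sqrt (R\<^sup>2)" by (intro real_sqrt_le_mono) simp
    then have sR: "?s \<le> R" using R by simp
    have mem0: "(x0, y) \<in> ?B" if "y \<in> ball y0 ?s" for y
      using that sR z by (simp add: dist_prod_def)
    have sub: "{x0} \<times> cball y0 ?s \<subseteq> cball z R"
      using sR z by (auto simp: dist_prod_def)
    have "(\<integral>\<^sup>+y. w (x0, y) * indicator ?B (x, y) \<partial>lborel)
        = (\<integral>\<^sup>+y\<in>ball y0 ?s. e2ennreal (ereal M - u (x0, y)) \<partial>lborel)"
      by (intro nn_integral_cong) (use mem0 in \<open>simp add: ind w_def mem indicator_def del: mem_ball\<close>)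
    also have "\<dots> \<le> emeasure lborel (ball y0 ?s) * e2ennreal (ereal M - u (x0, y0))"
      by (rule subharmonic_on_submean[OF b[rule_format, of x0]])
         (use s sub R(2) M in \<open>auto 0 4 intro!: M(2)\<close>)
    also have "\<dots> = (\<integral>\<^sup>+y. w z * indicator ?B (x, y) \<partial>lborel)"
    proof -
      have "w z = e2ennreal (ereal M - u (x0, y0))" using R z by (simp add: w_def)
      then show ?thesis by (simp add: ind nn_integral_cmult_indicator mult.commute)
    qed
    finally show ?thesis .
  next
    case False
    then have "(x, y) \<notin> ?B" for y
      using section_ball_snd[of x x0 y0 R] z by auto
    then show ?thesis by simp
  qed
  have "(\<integral>\<^sup>+p\<in>?B. e2ennreal (ereal M - u p) \<partial>lborel) = (\<integral>\<^sup>+p. w p * indicator ?B p \<partial>(lborel \<Otimes>\<^sub>M lborel))"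
    unfolding lborel_prod by (intro nn_integral_cong) (auto simp: w_def indicator_def)
  also have "\<dots> = (\<integral>\<^sup>+y. \<integral>\<^sup>+x. w (x, y) * indicator ?B (x, y) \<partial>lborel \<partial>lborel)"
    by (rule lborel_pair.nn_integral_snd[symmetric]) measurable
  also have "\<dots> \<le> (\<integral>\<^sup>+y. \<integral>\<^sup>+x. w (x0, y) * indicator ?B (x, y) \<partial>lborel \<partial>lborel)"
    by (intro nn_integral_mono sec1)
  also have "\<dots> = (\<integral>\<^sup>+x. \<integral>\<^sup>+y. w (x0, y) * indicator ?B (x, y) \<partial>lborel \<partial>lborel)"
    by (rule lborel_pair.Fubini'[symmetric]) measurable
  also have "\<dots> \<le> (\<integral>\<^sup>+x. \<integral>\<^sup>+y. w z * indicator ?B (x, y) \<partial>lborel \<partial>lborel)"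
    by (intro nn_integral_mono sec2)
  also have "\<dots> = (\<integral>\<^sup>+p. w z * indicator ?B p \<partial>(lborel \<Otimes>\<^sub>M lborel))"
    by (rule lborel.nn_integral_fst) measurable
  also have "\<dots> = emeasure lborel ?B * e2ennreal (ereal M - u z)"
    unfolding lborel_prod using R
    by (simp add: nn_integral_cmult_indicator w_def mult.commute[of "emeasure _ _"])
  finally have main: "(\<integral>\<^sup>+p\<in>?B. e2ennreal (ereal M - u p) \<partial>lborel) \<le> emeasure lborel ?B * e2ennreal (ereal M - u z)" .
  have uscB: "upper_semicontinuous_on ?B u"
    using R(2) B by (intro upper_semicontinuous_on_subset[OF usc]) blast
  show "u z \<le> ereal_set_integral ?B u / ereal (measure lebesgue (ball (0::'a \<times> 'b) 1) * R ^ DIM('a \<times> 'b))"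
    by (rule iffD2[OF submean_iff main])
       (use uscB R B M in auto)
qed (use assms in auto)

section \<open>Domar's bound for subharmonic functions\<close>

lemma power_sum_ge_two_terms:
  fixes X Y :: real
  assumes "0 \<le> X" "0 \<le> Y"
  shows "Y ^ n + n * X * Y ^ (n - 1) \<le> (X + Y) ^ n"
proof (induction n)
  case (Suc n)
  have Y: "real n * (Y * Y ^ (n - 1)) = real n * Y ^ n"
    by (cases n) auto
  have "Y ^ Suc n + Suc n * X * Y ^ n \<le> Y ^ Suc n + Suc n * X * Y ^ n + n * X\<^sup>2 * Y ^ (n - 1)"
    using assms by simp
  also have "\<dots> = Y * Y ^ n + X * Y ^ n + X * (real n * (Y * Y ^ (n - 1))) + n * X\<^sup>2 * Y ^ (n - 1)"
    by (simp only: Y) (simp add: algebra_simps)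
  also have "\<dots> = (X + Y) * (Y ^ n + n * X * Y ^ (n - 1))"
    by (simp add: algebra_simps power2_eq_square)
  also have "\<dots> \<le> (X + Y) * (X + Y) ^ n"
    using Suc assms by (intro mult_left_mono) auto
  finally show ?case by simp
qed simp

text \<open>
  A subharmonic function with a large value at a point \<open>x\<close> must, in a ball around \<open>x\<close>, either
  reach twice that value or be comparable to it on a third of the ball. Indeed, if \<open>v < 4h\<close> on the
  ball, then the mean of \<open>4h - v\<close> is at most \<open>4h - v(x) \<le> 2h\<close>, whereas \<open>4h - v \<ge> 3h\<close> off the set where
  \<open>h \<le> v < 4h\<close>; so this set has at least a third of the volume of the ball.
\<close>

lemma subharmonic_doubling_step:
  fixes v :: "'a::euclidean_space \<Rightarrow> ereal"
  assumes sub: "subharmonic_on D v" and D: "cball x \<rho> \<subseteq> D" "\<rho> > 0"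
    and band: "band \<in> sets borel" "emeasure lborel band \<le> ennreal \<mu>" "0 \<le> \<mu>"
      "\<And>y. y \<in> ball x \<rho> \<Longrightarrow> ereal h \<le> v y \<Longrightarrow> v y < ereal (4 * h) \<Longrightarrow> y \<in> band"
    and h: "h > 0" and vx: "ereal (2 * h) \<le> v x"
    and big: "3 * \<mu> < unit_ball_vol DIM('a) * \<rho> ^ DIM('a)"
  obtains y where "y \<in> ball x \<rho>" "ereal (4 * h) \<le> v y"
proof (rule ccontr)
  assume "\<not> thesis"
  with that have less: "v y < ereal (4 * h)" if "y \<in> ball x \<rho>" for y
    using that by (meson not_le)
  define V where "V = unit_ball_vol DIM('a) * \<rho> ^ DIM('a)"
  have V: "emeasure lborel (ball x \<rho>) = ennreal V" "0 \<le> V"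
    using D(2) by (auto simp: V_def emeasure_ball)
  have "ennreal (3 * h) * ennreal V
      = (\<integral>\<^sup>+y. ennreal (3 * h) * indicator (ball x \<rho>) y \<partial>lborel)"
    by (simp add: nn_integral_cmult_indicator V)
  also have "\<dots> \<le> (\<integral>\<^sup>+y. (e2ennreal (ereal (4 * h) - v y) * indicator (ball x \<rho>) y)
        + ennreal (3 * h) * indicator band y \<partial>lborel)"
  proof (rule nn_integral_mono)
    fix y
    show "ennreal (3 * h) * indicator (ball x \<rho>) y
      \<le> e2ennreal (ereal (4 * h) - v y) * indicator (ball x \<rho>) y + ennreal (3 * h) * indicator band y"
    proof (cases "y \<in> ball x \<rho> \<and> y \<notin> band")
      case True
      then have "\<not> ereal h \<le> v y" using band(4)[of y] less[of y] by auto
      then have "v y \<le> ereal h" by simp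
      then show ?thesis
        using True e2ennreal_diff_le_iff[of h "4 * h" "v y"] h by auto
    qed (auto simp: indicator_def)
  qed
  also have "\<dots> \<le> (\<integral>\<^sup>+y. e2ennreal (ereal (4 * h) - v y) * indicator (ball x \<rho>) y \<partial>lborel)
      + (\<integral>\<^sup>+y. ennreal (3 * h) * indicator band y \<partial>lborel)"
  proof -
    have "(\<lambda>y. e2ennreal (ereal (4 * h) - v y) * indicator (ball x \<rho>) y) \<in> borel_measurable borel"
      using sub D(1) ball_subset_cball[of x \<rho>] by (intro borel_measurable_e2ennreal_diff) auto
    then show ?thesis
      using band(1) by (subst nn_integral_add) auto
  qed
  also have "\<dots> \<le> ennreal V * ennreal (2 * h) + ennreal (3 * h) * ennreal \<mu>"
  proof (rule add_mono)
    have "(\<integral>\<^sup>+y. e2ennreal (ereal (4 * h) - v y) * indicator (ball x \<rho>) y \<partial>lborel)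
        \<le> emeasure lborel (ball x \<rho>) * e2ennreal (ereal (4 * h) - v x)"
      using less h by (intro subharmonic_on_submean[OF sub D]) (auto intro: less_imp_le)
    also have "ereal (4 * h) - v x \<le> ereal (4 * h) - ereal (2 * h)"
      using vx by (intro ereal_minus_mono) auto
    then have "e2ennreal (ereal (4 * h) - v x) \<le> ennreal (2 * h)"
      using e2ennreal_mono by fastforce
    finally show "(\<integral>\<^sup>+y. e2ennreal (ereal (4 * h) - v y) * indicator (ball x \<rho>) y \<partial>lborel) \<le> ennreal V * ennreal (2 * h)"
      by (simp add: V mult_left_mono)
    show "(\<integral>\<^sup>+y. ennreal (3 * h) * indicator band y \<partial>lborel) \<le> ennreal (3 * h) * ennreal \<mu>"
      using band h by (simp add: nn_integral_cmult_indicator mult_left_mono)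
  qed
  finally have "3 * h * V \<le> V * (2 * h) + 3 * h * \<mu>"
    using h V band(3) by (simp add: ennreal_mult[symmetric] ennreal_plus[symmetric] del: ennreal_plus)
  then have "h * V \<le> h * (3 * \<mu>)" by (simp add: algebra_simps)
  then show False using big h by (simp add: V_def)
qed

text \<open>
  Domar's argument. If \<open>v(x\<^sub>0) \<ge> 2^(t+1)\<close>, then the doubling step produces points \<open>x\<^sub>0, x\<^sub>1, \<dots>\<close> with
  \<open>v(x\<^sub>i) \<ge> 2^(t+i+1)\<close> and \<open>|x\<^sub>i\<^sub>+\<^sub>1 - x\<^sub>i| < R\<^sub>i\<close>, provided that three times the measure \<open>\<mu>\<^sub>i\<close> of the band
  \<open>2^(t+i) \<le> v < 2^(t+i+2)\<close> is less than the volume of a ball of radius \<open>R\<^sub>i\<close>. If \<open>\<Sum> R\<^sub>i \<le> r\<close>, the points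
  never leave the compact ball \<open>cball x0 r\<close>, on which \<open>v\<close> is bounded: a contradiction.

  The radii are \<open>R\<^sub>i = A w\<^sub>i \<mu>\<^sub>i + B a\<^sub>i\<close> with \<open>w\<^sub>i = a\<^sub>i^(1-N)\<close>. The binomial theorem gives
  \<open>R\<^sub>i^N > N A B^(N-1) \<mu>\<^sub>i\<close>, and \<open>A\<close> is chosen in terms of \<open>B\<close> to make this large enough. The terms
  \<open>B a\<^sub>i\<close> use up half of \<open>r\<close> if \<open>B = r / (2S)\<close>. Since \<open>H \<ge> w\<^sub>i\<close> almost everywhere on the \<open>i\<close>-th band and no point
  lies in more than two bands, \<open>\<Sum> w\<^sub>i \<mu>\<^sub>i \<le> 2I\<close>, and smallness of \<open>I S^(N-1)\<close> keeps the other terms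
  within the second half.
\<close>

lemma subharmonic_domar_bound:
  fixes v :: "'a::euclidean_space \<Rightarrow> ereal" and a :: "nat \<Rightarrow> real" and H :: "'a \<Rightarrow> ennreal"
  assumes sub: "subharmonic_on D v" and D: "cball x0 r \<subseteq> D" "r > 0"
    and a: "\<And>i. a i > 0" "\<And>k. (\<Sum>i<k. a i) \<le> S"
    and H: "H \<in> borel_measurable borel"
    and HI: "(\<integral>\<^sup>+x\<in>cball x0 r. H x \<partial>lborel) \<le> ennreal I" "0 \<le> I"
    and AE: "AE x in lborel. \<forall>i. x \<in> cball x0 r \<longrightarrow> ereal (2 ^ (t + i)) \<le> v x
               \<longrightarrow> ennreal (1 / a i ^ (DIM('a) - 1)) \<le> H x"
    and small: "6 * 2 ^ DIM('a) * I * S ^ (DIM('a) - 1) \<le> DIM('a) * unit_ball_vol DIM('a) * r ^ DIM('a)"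
  shows "v x0 < ereal (2 ^ (t + 1))"
proof (rule ccontr)
  assume "\<not> ?thesis"
  then have start: "ereal (2 ^ (t + 1)) \<le> v x0" by simp
  define N where "N = DIM('a)"
  define V where "V = unit_ball_vol DIM('a)"
  have N: "N > 0" and V: "V > 0" by (auto simp: N_def V_def)
  have S: "S > 0" using a(1)[of 0] a(2)[of 1] by simp
  define B where "B = r / (2 * S)"
  define A where "A = 3 / (N * V * B ^ (N - 1))"
  have B: "B > 0" and A: "A > 0" using D(2) S V N by (auto simp: A_def B_def)
  define w where "w i = 1 / a i ^ (N - 1)" for i
  have w: "w i > 0" for i using a(1)[of i] by (simp add: w_def)
  define band where "band i = {x \<in> cball x0 r. ereal (2 ^ (t + i)) \<le> v x \<and> v x < ereal (2 ^ (t + i + 2))}" for i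
  define \<mu> where "\<mu> i = measure lborel (band i)" for i
  define R where "R i = A * w i * \<mu> i + B * a i" for i
  have band: "band i \<in> sets borel" for i
  proof -
    define f where "f x = (if x \<in> D then v x else -\<infinity>)" for x
    have [measurable]: "f \<in> borel_measurable borel"
      unfolding f_def using sub by (intro upper_semicontinuous_on_borel_measurable) (auto simp: subharmonic_on_def)
    have "band i = cball x0 r \<inter> {x \<in> space borel. ereal (2 ^ (t + i)) \<le> f x \<and> f x < ereal (2 ^ (t + i + 2))}"
      unfolding band_def f_def using D(1) by auto
    moreover have "{x \<in> space borel. ereal (2 ^ (t + i)) \<le> f x \<and> f x < ereal (2 ^ (t + i + 2))} \<in> sets borel"
      by measurable
    ultimately show ?thesis by auto
  qed
  have \<mu>: "emeasure lborel (band i) = ennreal (\<mu> i)" "0 \<le> \<mu> i" for i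
  proof -
    have "emeasure lborel (band i) \<le> emeasure lborel (cball x0 r)"
      by (rule emeasure_mono) (auto simp: band_def)
    also have "\<dots> < \<infinity>" using D(2) by (simp add: emeasure_cball)
    finally show "emeasure lborel (band i) = ennreal (\<mu> i)"
      unfolding \<mu>_def by (intro emeasure_eq_ennreal_measure) auto
  qed (simp add: \<mu>_def)
  have R0: "R i > 0" for i
    unfolding R_def using A B w[of i] \<mu>(2)[of i] a(1)[of i] by (intro add_nonneg_pos) auto
  have big: "3 * \<mu> i < V * R i ^ N" for i
  proof -
    have aw: "a i ^ (N - 1) * w i = 1" using a(1)[of i] by (simp add: w_def)
    have "3 * \<mu> i = V * (N * (A * w i * \<mu> i) * (B * a i) ^ (N - 1))"
    proof -
      have "V * (N * (A * w i * \<mu> i) * (B * a i) ^ (N - 1)) = (N * V * B ^ (N - 1) * A) * (a i ^ (N - 1) * w i) * \<mu> i"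
        by (simp add: power_mult_distrib mult_ac)
      also have "N * V * B ^ (N - 1) * A = 3" using N V B by (simp add: A_def)
      finally show ?thesis unfolding aw mult_1_right by (rule sym)
    qed
    also have "\<dots> < V * ((B * a i) ^ N + N * (A * w i * \<mu> i) * (B * a i) ^ (N - 1))"
      using V B a(1)[of i] by simp
    also have "\<dots> \<le> V * R i ^ N"
      unfolding R_def using V A B w[of i] a(1)[of i] \<mu>(2)[of i]
      by (intro mult_left_mono power_sum_ge_two_terms) auto
    finally show ?thesis .
  qed
  have wsum: "(\<Sum>i<k. w i * \<mu> i) \<le> 2 * I" for k
  proof -
    have "ennreal (\<Sum>i<k. w i * \<mu> i) = (\<Sum>i<k. ennreal (w i) * emeasure lborel (band i))"
      using w \<mu> by (simp add: sum_ennreal[symmetric] ennreal_mult less_imp_le)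
    also have "\<dots> = (\<Sum>i<k. \<integral>\<^sup>+x. ennreal (w i) * indicator (band i) x \<partial>lborel)"
      using band by (simp add: nn_integral_cmult_indicator)
    also have "\<dots> = (\<integral>\<^sup>+x. (\<Sum>i<k. ennreal (w i) * indicator (band i) x) \<partial>lborel)"
      using band by (subst nn_integral_sum) auto
    also have "\<dots> \<le> (\<integral>\<^sup>+x. 2 * (H x * indicator (cball x0 r) x) \<partial>lborel)"
    proof (rule nn_integral_mono_AE, use AE in eventually_elim)
      case (elim x)
      \<comment> \<open>the indices of the bands through \<open>x\<close>: at most two, and consecutive\<close>
      define F where "F = {i. i < k \<and> x \<in> band i}"
      have "finite F" by (simp add: F_def)
      have "card F \<le> 2"
      proof (cases "F = {}")
        case False
        define j where "j = Min F"
        have j: "j \<in> F" using \<open>finite F\<close> False by (simp add: j_def)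
        have "F \<subseteq> {j, j + 1}"
        proof
          fix i assume i: "i \<in> F"
          then have "j \<le> i" using \<open>finite F\<close> by (simp add: j_def)
          have "ereal (2 ^ (t + i)) \<le> v x" "v x < ereal (2 ^ (t + j + 2))"
            using i j by (auto simp: F_def band_def)
          then have "ereal (2 ^ (t + i)) < ereal (2 ^ (t + j + 2))" by (rule le_less_trans)
          then have "(2::real) ^ (t + i) < 2 ^ (t + j + 2)" by (simp only: ereal_less_eq less_ereal.simps)
          then have "t + i < t + j + 2" by (rule power_less_imp_less_exp[rotated]) simp
          then have "i < j + 2" by simp
          with \<open>j \<le> i\<close> show "i \<in> {j, j + 1}" by auto
        qed
        then have "card F \<le> card {j, j + 1}" by (intro card_mono) auto
        then show ?thesis by simp
      qed simp
      have "(\<Sum>i<k. ennreal (w i) * indicator (band i) x) = (\<Sum>i\<in>F. ennreal (w i))"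
        unfolding F_def by (intro sum.mono_neutral_cong_right) auto
      also have "\<dots> \<le> (\<Sum>i\<in>F. H x * indicator (cball x0 r) x)"
        using elim by (intro sum_mono) (auto simp: F_def band_def w_def N_def)
      also have "\<dots> = of_nat (card F) * (H x * indicator (cball x0 r) x)"
        by simp
      also have "\<dots> \<le> of_nat 2 * (H x * indicator (cball x0 r) x)"
        using \<open>card F \<le> 2\<close> by (intro mult_right_mono of_nat_mono) auto
      finally show ?case by simp
    qed
    also have "\<dots> = 2 * (\<integral>\<^sup>+x\<in>cball x0 r. H x \<partial>lborel)"
      using H by (intro nn_integral_cmult) (auto intro!: borel_measurable_times_ennreal borel_measurable_indicator)
    also have "\<dots> \<le> 2 * ennreal I" using HI(1) by (rule mult_left_mono) simp
    also have "\<dots> = ennreal (2 * I)" using HI(2) by (simp add: ennreal_mult)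
    finally show ?thesis using HI(2) by (simp add: ennreal_le_iff)
  qed
  have Rsum: "(\<Sum>i<k. R i) \<le> r" for k
  proof -
    have "(\<Sum>i<k. R i) = A * (\<Sum>i<k. w i * \<mu> i) + B * (\<Sum>i<k. a i)"
      by (simp add: R_def sum.distrib sum_distrib_left mult.assoc)
    also have "\<dots> \<le> A * (2 * I) + B * S"
      using A B wsum a(2) by (intro add_mono mult_left_mono) auto
    also have "B * S = r / 2" using S by (simp add: B_def)
    also have "A * (2 * I) \<le> r / 2"
    proof -
      have small': "6 * 2 ^ N * I * S ^ (N - 1) \<le> N * V * r ^ N"
        using small by (simp add: N_def V_def)
      have pw: "B ^ (N - 1) = r ^ (N - 1) / (2 ^ (N - 1) * S ^ (N - 1))"
        by (simp add: B_def power_divide power_mult_distrib)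
      have e: "2 ^ N = 2 * (2::real) ^ (N - 1)" "r ^ N = r * r ^ (N - 1)"
        using N by (metis Suc_diff_1 power_Suc)+
      have "12 * I * 2 ^ (N - 1) * S ^ (N - 1) \<le> r * (N * V * r ^ (N - 1))"
        using small' unfolding e by (simp add: mult_ac)
      then have "12 * I \<le> r * (N * V * B ^ (N - 1))"
        unfolding pw using S by (simp add: field_simps)
      then show ?thesis
        using N V B unfolding A_def by (simp add: field_simps)
    qed
    finally show ?thesis by simp
  qed
  have chain: "\<exists>x. dist x0 x \<le> (\<Sum>i<k. R i) \<and> ereal (2 ^ (t + k + 1)) \<le> v x" for k
  proof (induction k)
    case 0
    then show ?case using start by (intro exI[of _ x0]) simp
  next
    case (Suc k)
    then obtain x where x: "dist x0 x \<le> (\<Sum>i<k. R i)" "ereal (2 ^ (t + k + 1)) \<le> v x" by blast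
    have sub': "cball x (R k) \<subseteq> cball x0 r"
    proof
      fix y assume "y \<in> cball x (R k)"
      then show "y \<in> cball x0 r"
        using dist_triangle[of x0 y x] x(1) Rsum[of "Suc k"] by simp
    qed
    \<comment> \<open>the doubling step is applied with \<open>h = 2^(t+k)\<close>\<close>
    have four: "4 * 2 ^ (t + k) = (2::real) ^ (t + k + 2)" "2 * 2 ^ (t + k) = (2::real) ^ (t + k + 1)"
      by (simp_all add: power_add)
    have inb: "y \<in> band k"
      if "y \<in> ball x (R k)" "ereal (2 ^ (t + k)) \<le> v y" "v y < ereal (4 * 2 ^ (t + k))" for y
    proof -
      have "y \<in> cball x0 r" using that(1) sub' by force
      then show ?thesis using that(2,3) unfolding band_def four by blast
    qed
    obtain y where y: "y \<in> ball x (R k)" "ereal (4 * 2 ^ (t + k)) \<le> v y"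
    proof (rule subharmonic_doubling_step[OF sub _ R0[of k] band[of k] _ \<mu>(2)[of k]])
      show "cball x (R k) \<subseteq> D" using sub' D(1) by blast
      show "emeasure lborel (band k) \<le> ennreal (\<mu> k)" using \<mu>(1) by simp
      show "ereal (2 * 2 ^ (t + k)) \<le> v x" using x(2) unfolding four .
      show "3 * \<mu> k < unit_ball_vol DIM('a) * R k ^ DIM('a)" using big[of k] by (simp add: V_def N_def)
    qed (use inb in auto)
    have "dist x0 y \<le> (\<Sum>i<Suc k. R i)"
      using dist_triangle[of x0 y x] x(1) y(1) by simp
    moreover have "ereal (2 ^ (t + Suc k + 1)) \<le> v y"
      using y(2) unfolding four by simp
    ultimately show ?case by blast
  qed
  have usc: "upper_semicontinuous_on (cball x0 r) v" and fin: "\<And>x. x \<in> cball x0 r \<Longrightarrow> v x < \<infinity>"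
    using sub D(1) by (auto simp: subharmonic_on_def intro: upper_semicontinuous_on_subset)
  have "\<exists>M. \<forall>x\<in>cball x0 r. v x \<le> ereal M"
    by (rule upper_semicontinuous_on_compact_bounded[OF usc compact_cball fin]) blast+
  then obtain M where M: "\<And>x. x \<in> cball x0 r \<Longrightarrow> v x \<le> ereal M"
    by blast
  obtain k where k: "M < 2 ^ k" using real_arch_pow[of 2 M] by auto
  obtain x where x: "dist x0 x \<le> (\<Sum>i<k. R i)" "ereal (2 ^ (t + k + 1)) \<le> v x"
    using chain by blast
  have "x \<in> cball x0 r" using x(1) Rsum[of k] by simp
  then have "ereal (2 ^ (t + k + 1)) \<le> ereal M" using M x(2) order_trans by blast
  moreover have "(2::real) ^ k \<le> 2 ^ (t + k + 1)" by (intro power_increasing) auto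
  ultimately show False using k by simp
qed

section \<open>Series of powers of tails\<close>

text \<open>Increments of a concave function decrease.\<close>

lemma powr_increment_antimono:
  fixes s t a q :: real
  assumes "0 < q" "q \<le> 1" "0 \<le> a" "0 \<le> s" "s \<le> t"
  shows "(t + a) powr q - t powr q \<le> (s + a) powr q - s powr q"
proof (rule DERIV_nonpos_imp_decreasing_open[where f = "\<lambda>x. (x + a) powr q - x powr q", OF \<open>s \<le> t\<close>])
    fix x assume x: "s < x" "x < t"
    then have "x > 0" using assms by simp
    have "((\<lambda>x. (x + a) powr q - x powr q) has_real_derivative
            q * (x + a) powr (q - 1) - q * x powr (q - 1)) (at x)"
      using \<open>x > 0\<close> assms by (auto intro!: derivative_eq_intros simp: powr_diff)
    moreover have "(x + a) powr (q - 1) \<le> x powr (q - 1)"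
      using \<open>x > 0\<close> assms by (intro powr_mono2') auto
    then have "q * (x + a) powr (q - 1) - q * x powr (q - 1) \<le> 0"
      using assms by simp
    ultimately show "\<exists>y. ((\<lambda>x. (x + a) powr q - x powr q) has_real_derivative y) (at x) \<and> y \<le> 0"
      by blast
  next
    show "continuous_on {s..t} (\<lambda>x. (x + a) powr q - x powr q)"
      using assms by (intro continuous_on_diff continuous_on_powr' continuous_intros) auto
qed

text \<open>
  A Hardy-type inequality for a decreasing sequence and an exponent \<open>q \<le> 1\<close>. Appending a term
  \<open>a = \<alpha>\<^sub>M\<^sub>+\<^sub>1\<close> adds \<open>a\<close> to each tail \<open>\<Sum>\<^bsub>j=t..M\<^esub> \<alpha>\<^sub>j\<close>, which is at least \<open>(M+1-t) a\<close>. By concavity its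
  \<open>q\<close>-th power grows by at most \<open>((M+2-t) a)^q - ((M+1-t) a)^q\<close>, and the sum over \<open>t\<close> telescopes to
  \<open>((M+1) a)^q\<close>, the new term on the right.
\<close>

lemma sum_powr_tails_le:
  fixes \<alpha> :: "nat \<Rightarrow> real"
  assumes q: "0 < q" "q \<le> 1" and pos: "\<And>j. j \<ge> 1 \<Longrightarrow> \<alpha> j \<ge> 0"
    and anti: "\<And>i j. 1 \<le> i \<Longrightarrow> i \<le> j \<Longrightarrow> \<alpha> j \<le> \<alpha> i"
  shows "(\<Sum>t=1..M. (\<Sum>j=t..M. \<alpha> j) powr q) \<le> (\<Sum>j=1..M. (real j * \<alpha> j) powr q)"
proof (induction M)
  case (Suc M)
  let ?a = "\<alpha> (Suc M)"
  have inc: "(\<Sum>j=t..Suc M. \<alpha> j) powr q - (\<Sum>j=t..M. \<alpha> j) powr q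
     \<le> (real (Suc M - t + 1) * ?a) powr q - (real (Suc M - t) * ?a) powr q"
    if t: "t \<in> {1..Suc M}" for t
  proof -
    have "real (Suc M - t) * ?a = (\<Sum>j=t..M. ?a)" using t by simp
    also have "\<dots> \<le> (\<Sum>j=t..M. \<alpha> j)" using t by (intro sum_mono anti) auto
    finally have le: "real (Suc M - t) * ?a \<le> (\<Sum>j=t..M. \<alpha> j)" .
    have "(\<Sum>j=t..Suc M. \<alpha> j) = (\<Sum>j=t..M. \<alpha> j) + ?a" using t by simp
    moreover have "real (Suc M - t + 1) * ?a = real (Suc M - t) * ?a + ?a"
      by (simp add: algebra_simps)
    ultimately show ?thesis
      using powr_increment_antimono[OF q _ _ le, of ?a] pos[of "Suc M"] by simp
  qed
  have "(\<Sum>t=1..Suc M. (\<Sum>j=t..Suc M. \<alpha> j) powr q) - (\<Sum>t=1..Suc M. (\<Sum>j=t..M. \<alpha> j) powr q)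
     \<le> (\<Sum>t=1..Suc M. (real (Suc M - t + 1) * ?a) powr q - (real (Suc M - t) * ?a) powr q)"
    unfolding sum_subtractf[symmetric] by (rule sum_mono) (rule inc)
  also have "\<dots> = (\<Sum>i<Suc M. (real (Suc i) * ?a) powr q - (real i * ?a) powr q)"
    by (rule sum.reindex_bij_witness[of _ "\<lambda>i. Suc M - i" "\<lambda>t. Suc M - t"]) auto
  also have "\<dots> = (real (Suc M) * ?a) powr q"
    by (subst sum_lessThan_telescope) (use q in simp)
  also have "(\<Sum>t=1..Suc M. (\<Sum>j=t..M. \<alpha> j) powr q) = (\<Sum>t=1..M. (\<Sum>j=t..M. \<alpha> j) powr q)"
    by simp
  finally show ?case using Suc by simp
qed simp

text \<open>
  The previous inequality bounds all finite truncations by the same sum \<open>W\<close>. Its first term, \<open>t = 1\<close>, gives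
  convergence of \<open>\<Sum> \<alpha>\<^sub>j\<close>, after which each of the first \<open>L\<close> tails may be completed by letting \<open>M\<close> tend to
  infinity.
\<close>

lemma summable_powr_tails:
  fixes \<alpha> :: "nat \<Rightarrow> real"
  assumes q: "0 < q" "q \<le> 1" and pos: "\<And>j. j \<ge> 1 \<Longrightarrow> \<alpha> j > 0"
    and anti: "\<And>i j. 1 \<le> i \<Longrightarrow> i \<le> j \<Longrightarrow> \<alpha> j \<le> \<alpha> i"
    and summable: "summable (\<lambda>j. (real j * \<alpha> j) powr q)"
  shows "summable \<alpha>" and "summable (\<lambda>t. (\<Sum>i. \<alpha> (t + i)) powr q)"
proof -
  define W where "W = (\<Sum>j. (real j * \<alpha> j) powr q)"
  have W: "(\<Sum>t=1..M. (\<Sum>j=t..M. \<alpha> j) powr q) \<le> W" for M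
  proof -
    have "(\<Sum>t=1..M. (\<Sum>j=t..M. \<alpha> j) powr q) \<le> (\<Sum>j=1..M. (real j * \<alpha> j) powr q)"
      using sum_powr_tails_le[OF q] pos anti by (simp add: less_imp_le)
    also have "\<dots> \<le> W"
      unfolding W_def using summable by (intro sum_le_suminf) auto
    finally show ?thesis .
  qed
  have "W \<ge> 0" unfolding W_def using summable by (intro suminf_nonneg) auto
  have "(\<Sum>j<k. \<alpha> (Suc j)) \<le> W powr (1 / q)" for k
  proof (cases "k = 0")
    case False
    have nn: "0 \<le> (\<Sum>j=1..k. \<alpha> j)" using pos by (intro sum_nonneg) (auto intro: less_imp_le)
    have "(\<Sum>j=1..k. \<alpha> j) powr q \<le> (\<Sum>t=1..k. (\<Sum>j=t..k. \<alpha> j) powr q)"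
      using False by (intro member_le_sum) auto
    also note W
    finally have "((\<Sum>j=1..k. \<alpha> j) powr q) powr (1 / q) \<le> W powr (1 / q)"
      using q by (intro powr_mono2) auto
    then show ?thesis
      using q nn by (simp add: powr_powr sum.shift_bounds_Suc_ivl[symmetric] lessThan_atLeast0 atLeastLessThanSuc_atLeastAtMost)
  qed simp
  then have "summable (\<lambda>j. \<alpha> (Suc j))"
    using pos by (intro summableI_nonneg_bounded[where x = "W powr (1 / q)"]) (auto intro: less_imp_le)
  then show sum\<alpha>: "summable \<alpha>" by (simp add: summable_Suc_iff)
  have tail: "(\<lambda>M. \<Sum>j=t..M. \<alpha> j) \<longlonglongrightarrow> (\<Sum>i. \<alpha> (t + i))" for t
  proof (rule LIMSEQ_offset[where k = t])
    have "(\<Sum>j=t..n + t. \<alpha> j) = (\<Sum>i\<le>n. \<alpha> (t + i))" for n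
      by (rule sum.reindex_bij_witness[of _ "\<lambda>i. t + i" "\<lambda>j. j - t"]) auto
    moreover have "summable (\<lambda>i. \<alpha> (t + i))"
      using sum\<alpha> by (simp add: add.commute summable_iff_shift)
    ultimately show "(\<lambda>n. \<Sum>j=t..n + t. \<alpha> j) \<longlonglongrightarrow> (\<Sum>i. \<alpha> (t + i))"
      by (simp add: summable_LIMSEQ')
  qed
  have tailpos: "(\<Sum>i. \<alpha> (t + i)) > 0" if "t \<ge> 1" for t
    using that pos sum\<alpha> by (intro suminf_pos) (auto simp: add.commute summable_iff_shift)
  have bound: "(\<Sum>t=1..L. (\<Sum>i. \<alpha> (t + i)) powr q) \<le> W" for L
  proof (rule LIMSEQ_le_const2)
    show "(\<lambda>M. \<Sum>t=1..L. (\<Sum>j=t..M. \<alpha> j) powr q) \<longlonglongrightarrow> (\<Sum>t=1..L. (\<Sum>i. \<alpha> (t + i)) powr q)"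
      using tailpos by (intro tendsto_sum tendsto_powr tail tendsto_const) (metis atLeastAtMost_iff less_irrefl)
    have "(\<Sum>t=1..L. (\<Sum>j=t..M. \<alpha> j) powr q) \<le> W" if "M \<ge> L" for M
    proof -
      have "(\<Sum>t=1..L. (\<Sum>j=t..M. \<alpha> j) powr q) \<le> (\<Sum>t=1..M. (\<Sum>j=t..M. \<alpha> j) powr q)"
        using that by (intro sum_mono2) auto
      with W[of M] show ?thesis by linarith
    qed
    then show "\<exists>N. \<forall>M\<ge>N. (\<Sum>t=1..L. (\<Sum>j=t..M. \<alpha> j) powr q) \<le> W" by blast
  qed
  have "(\<Sum>t<k. (\<Sum>i. \<alpha> (Suc t + i)) powr q) \<le> W" for k
  proof -
    have "(\<Sum>t<k. (\<Sum>i. \<alpha> (Suc t + i)) powr q) = (\<Sum>t=1..k. (\<Sum>i. \<alpha> (t + i)) powr q)"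
      by (rule sum.reindex_bij_witness[of _ "\<lambda>t. t - 1" Suc]) auto
    then show ?thesis using bound[of k] by simp
  qed
  then have "summable (\<lambda>t. (\<Sum>i. \<alpha> (Suc t + i)) powr q)"
    by (intro summableI_nonneg_bounded[where x = W]) auto
  then show "summable (\<lambda>t. (\<Sum>i. \<alpha> (t + i)) powr q)"
    by (subst summable_Suc_iff[symmetric])
qed

text \<open>
  Integral test. On the interval \<open>(c (j-1), c j]\<close>, where \<open>h(s) \<ge> h(c j)\<close> and \<open>s \<ge> c j / 2\<close> for \<open>j \<ge> 2\<close>, the
  integrand is at least \<open>(c/2)^q\<close> times the \<open>j\<close>-th term. The first \<open>k\<close> indices are dropped so that
  the intervals lie in \<open>[1, \<infinity>)\<close>.
\<close>

lemma summable_of_nn_integral_antimono: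
  fixes h :: "real \<Rightarrow> real"
  assumes h: "\<And>s. s > 0 \<Longrightarrow> h s \<ge> 0" "\<And>s t. 0 < s \<Longrightarrow> s \<le> t \<Longrightarrow> h t \<le> h s"
    and "c > 0" "q \<ge> 0"
    and int: "(\<integral>\<^sup>+s\<in>{1..}. ennreal (s powr q * h s) \<partial>lebesgue) < \<infinity>"
  shows "summable (\<lambda>j. real j powr q * h (c * real j))"
proof -
  obtain k0 :: nat where k0: "1 / c < real k0" using reals_Archimedean2 by blast
  define k where "k = k0 + 2"
  have k: "k \<ge> 2" "c * (real j - 1) \<ge> 1" if "j \<ge> k" for j
  proof -
    show "k \<ge> 2" by (simp add: k_def)
    have "real k0 \<le> real j - 1" using that by (simp add: k_def)
    then have "1 / c \<le> real j - 1" using k0 by simp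
    then show "c * (real j - 1) \<ge> 1" using \<open>c > 0\<close> by (simp add: field_simps)
  qed
  define C where "C = (c / 2) powr q"
  have C: "C > 0" using \<open>c > 0\<close> by (simp add: C_def)
  define g where "g j = C * (real j powr q * h (c * real j))" for j
  define E where "E j = {c * (real j - 1)<..c * real j}" for j
  have E: "E j \<in> sets lebesgue" for j by (simp add: E_def)
  obtain T where T: "(\<integral>\<^sup>+s\<in>{1..}. ennreal (s powr q * h s) \<partial>lebesgue) = ennreal T" "0 \<le> T"
    using int by (cases "(\<integral>\<^sup>+s\<in>{1..}. ennreal (s powr q * h s) \<partial>lebesgue)") auto
  have g0: "g j \<ge> 0" if "j \<ge> k" for j
  proof -
    have "0 < c * real j" using that k(1)[OF that] \<open>c > 0\<close> by simp
    then show ?thesis using h(1) C by (simp add: g_def)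
  qed
  have le: "g j \<le> s powr q * h s" "s \<ge> 1" if j: "j \<ge> k" and s: "s \<in> E j" for j s
  proof -
    show "s \<ge> 1" using k[OF j] s by (simp add: E_def)
    have "real j / 2 \<le> real j - 1" using k(1)[OF j] j by simp
    then have "c * (real j / 2) \<le> c * (real j - 1)" using \<open>c > 0\<close> by (intro mult_left_mono) auto
    also have "\<dots> \<le> s" using s by (simp add: E_def)
    finally have "(c / 2 * real j) powr q \<le> s powr q"
      using \<open>c > 0\<close> \<open>q \<ge> 0\<close> by (intro powr_mono2) auto
    moreover have "(c / 2 * real j) powr q = C * real j powr q"
      unfolding C_def by (rule powr_mult)
    moreover have "h (c * real j) \<le> h s" "h (c * real j) \<ge> 0"
      using h s \<open>s \<ge> 1\<close> by (auto simp: E_def)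
    ultimately show "g j \<le> s powr q * h s"
      unfolding g_def mult.assoc[symmetric] by (intro mult_mono) auto
  qed
  have "(\<Sum>j<n. c * g (j + k)) \<le> T" for n
  proof -
    have uniq: "i = j" if "s \<in> E i" "s \<in> E j" for i j s
    proof -
      have "c * (real i - 1) < c * real j" "c * (real j - 1) < c * real i"
        using that by (auto simp: E_def intro: less_le_trans)
      then have "real i - 1 < real j" "real j - 1 < real i" using \<open>c > 0\<close> by auto
      then show ?thesis by linarith
    qed
    have "emeasure lebesgue (E j) = ennreal c" for j
      using \<open>c > 0\<close> by (simp add: E_def algebra_simps)
    then have "ennreal (\<Sum>j<n. c * g (j + k)) = (\<Sum>j<n. ennreal (g (j + k)) * emeasure lebesgue (E (j + k)))"
      using \<open>c > 0\<close> g0 by (simp add: sum_ennreal[symmetric] ennreal_mult mult.commute)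
    also have "\<dots> = (\<Sum>j<n. \<integral>\<^sup>+s. ennreal (g (j + k)) * indicator (E (j + k)) s \<partial>lebesgue)"
      using E by (simp add: nn_integral_cmult_indicator)
    also have "\<dots> = (\<integral>\<^sup>+s. (\<Sum>j<n. ennreal (g (j + k)) * indicator (E (j + k)) s) \<partial>lebesgue)"
      using E by (subst nn_integral_sum) (auto intro!: borel_measurable_times_ennreal borel_measurable_indicator)
    also have "\<dots> \<le> (\<integral>\<^sup>+s\<in>{1..}. ennreal (s powr q * h s) \<partial>lebesgue)"
    proof (rule nn_integral_mono)
      fix s
      show "(\<Sum>j<n. ennreal (g (j + k)) * indicator (E (j + k)) s) \<le> ennreal (s powr q * h s) * indicator {1..} s"
      proof (cases "\<exists>j<n. s \<in> E (j + k)")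
        case True
        then obtain i where i: "i < n" "s \<in> E (i + k)" by blast
        have "(\<Sum>j<n. ennreal (g (j + k)) * indicator (E (j + k)) s) = (\<Sum>j\<in>{i}. ennreal (g (j + k)))"
          using i uniq by (intro sum.mono_neutral_cong_right) (fastforce simp: indicator_def)+
        also have "\<dots> \<le> ennreal (s powr q * h s) * indicator {1..} s"
          using le[of "i + k" s] i by (simp add: ennreal_leI)
        finally show ?thesis .
      next
        case False
        then have "(\<Sum>j<n. ennreal (g (j + k)) * indicator (E (j + k)) s) = 0"
          by (intro sum.neutral) auto
        then show ?thesis by simp
      qed
    qed
    finally show ?thesis using T by (simp add: ennreal_le_iff)
  qed
  then have "summable (\<lambda>j. c * g (j + k))"
    using g0 \<open>c > 0\<close> by (intro summableI_nonneg_bounded[where x = T]) auto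
  then have "summable (\<lambda>j. (c * C) * (real j powr q * h (c * real j)))"
    unfolding g_def by (subst (asm) summable_iff_shift) (simp add: mult.assoc)
  then show ?thesis using \<open>c > 0\<close> C by (subst (asm) summable_cmult_iff) auto
qed

section \<open>Local boundedness of separately subharmonic functions\<close>

lemma strict_mono_surj_nonneg:
  fixes \<phi> :: "real \<Rightarrow> real"
  assumes "strict_mono_on {0..} \<phi>" "\<phi> ` {0..} = {0..}"
  shows "\<phi> 0 = 0" and "s > 0 \<Longrightarrow> \<phi> s > 0" and "0 \<le> s \<Longrightarrow> s \<le> t \<Longrightarrow> \<phi> s \<le> \<phi> t"
proof -
  obtain s0 where s0: "s0 \<ge> 0" "\<phi> s0 = 0" using assms(2) by (metis atLeast_iff imageE order_refl)
  have "\<phi> 0 \<ge> 0" using assms(2) by (metis atLeast_iff imageI order_refl)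
  then show 0: "\<phi> 0 = 0"
    using s0 strict_mono_onD[OF assms(1), of 0 s0] by (cases "s0 = 0") auto
  show "\<phi> s > 0" if "s > 0"
    using strict_mono_onD[OF assms(1), of 0 s] that 0 by simp
  show "\<phi> s \<le> \<phi> t" if "0 \<le> s" "s \<le> t"
    using strict_mono_onD[OF assms(1), of s t] that by (cases "s = t") auto
qed

lemma log_plus_powr_ge:
  assumes "ereal (2 ^ k) \<le> w" "w < \<infinity>" "p > 0"
  shows "p * ln 2 * real k \<le> log_plus (real_of_ereal (max w 0) powr p)"
proof -
  obtain s where s: "w = ereal s" "2 ^ k \<le> s" using assms by (cases w) auto
  have "s > 0" using s(2) by (rule less_le_trans[rotated]) simp
  have "ln (2 ^ k) \<le> ln s" using s(2) \<open>s > 0\<close> by simp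
  then have "p * (real k * ln 2) \<le> p * ln s" using assms(3) by (simp add: ln_realpow)
  moreover have "real_of_ereal (max w 0) = s"
    using s \<open>s > 0\<close> by (simp add: max_def)
  ultimately show ?thesis
    using \<open>s > 0\<close> by (simp add: log_plus_def ln_powr mult_ac)
qed

text \<open>
  The bound of Domar's type is applied in each factor. Put \<open>\<alpha>\<^sub>j = \<phi>(c j)^(-1/(n-1))\<close> with \<open>c = p ln 2\<close>, so that
  the integrand \<open>f = \<phi>(log\<^sup>+ (u\<^sup>+)^p)\<close> satisfies \<open>f \<ge> \<phi>(c j) = \<alpha>\<^sub>j^(1-n)\<close> where \<open>u \<ge> 2^j\<close>, and let
  \<open>S\<^sub>t = \<Sum>\<^bsub>j\<ge>t\<^esub> \<alpha>\<^sub>j\<close> and \<open>G(x) = \<integral> f(x, y) dy\<close>. For almost every \<open>x\<close>, the bound in \<open>y\<close> with \<open>H = f(x, \<cdot>)\<close>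
  shows that \<open>u(x, y) \<ge> 2^(t+1)\<close> forces \<open>G(x) \<ge> \<kappa> / S\<^sub>t^(n-1)\<close>, whatever \<open>y\<close> is. This is the hypothesis
  for the bound in \<open>x\<close> with \<open>H = G\<close>, \<open>\<beta> = const S^q\<close> and \<open>q = (n-1)/(m-1)\<close>. The terms \<open>\<beta>\<close> are summable by
  the Hardy-type inequality, because \<open>q \<le> 1\<close> and \<open>j^q \<alpha>\<^sub>j^q = j^q \<phi>(c j)^(-1/(m-1))\<close> is summable by (c1).
  A late enough tail of \<open>\<beta>\<close> then gives a bound for \<open>u\<close> that is uniform in \<open>x\<close> and \<open>y\<close>.
\<close>

lemma separately_subharmonic_locally_bounded:
  fixes \<Omega> :: "('a::euclidean_space \<times> 'b::euclidean_space) set"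
    and u :: "'a \<times> 'b \<Rightarrow> ereal" and \<phi> :: "real \<Rightarrow> real" and p :: real
  assumes dim: "DIM('b) \<ge> 2" "DIM('a) \<ge> DIM('b)"
    and "open \<Omega>" and fin: "\<And>z. z \<in> \<Omega> \<Longrightarrow> u z < \<infinity>"
    and a: "\<forall>y. subharmonic_on {x. (x, y) \<in> \<Omega>} (\<lambda>x. u (x, y))"
    and b: "\<forall>x. subharmonic_on {y. (x, y) \<in> \<Omega>} (\<lambda>y. u (x, y))"
    and \<phi>: "strict_mono_on {0..} \<phi>" "\<phi> ` {0..} = {0..}"
    and c1: "(\<integral>\<^sup>+s\<in>{1..}. ennreal (s powr ((real DIM('b) - 1) / (real DIM('a) - 1))
               / \<phi> s powr (1 / (real DIM('a) - 1))) \<partial>lebesgue) < \<infinity>"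
    and "p > 0"
    and c2: "locally_integrable_on (\<lambda>z. \<phi> (log_plus (real_of_ereal (max (u z) 0) powr p))) \<Omega>"
    and z: "z \<in> \<Omega>"
  shows "\<exists>W M. open W \<and> z \<in> W \<and> W \<subseteq> \<Omega> \<and> (\<forall>w\<in>W. u w \<le> ereal M)"
proof -
  note \<phi>0 = strict_mono_surj_nonneg(1)[OF \<phi>]
  note \<phi>_pos = strict_mono_surj_nonneg(2)[OF \<phi>]
  note \<phi>_mono = strict_mono_surj_nonneg(3)[OF \<phi>]
  define m where "m = DIM('a)"
  define n where "n = DIM('b)"
  have mn: "n \<ge> 2" "m \<ge> n" using dim by (auto simp: m_def n_def)
  define q where "q = (real n - 1) / (real m - 1)"
  have q: "0 < q" "q \<le> 1" using mn by (auto simp: q_def)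
  define c where "c = p * ln 2"
  have c: "c > 0" using \<open>p > 0\<close> by (simp add: c_def)

  define h where "h s = 1 / \<phi> s powr (1 / (real m - 1))" for s
  define \<alpha> where "\<alpha> j = \<phi> (c * real j) powr (- (1 / (real n - 1)))" for j :: nat
  define S where "S t = (\<Sum>i. \<alpha> (t + i))" for t
  have \<alpha>_pos: "\<alpha> j > 0" if "j \<ge> 1" for j
    using \<phi>_pos[of "c * real j"] c that by (simp add: \<alpha>_def)
  have \<alpha>_anti: "\<alpha> j \<le> \<alpha> i" if "1 \<le> i" "i \<le> j" for i j
  proof -
    have "\<phi> (c * real i) \<le> \<phi> (c * real j)" using that c by (intro \<phi>_mono) auto
    moreover have "0 < \<phi> (c * real i)" using that c by (intro \<phi>_pos) auto
    ultimately show ?thesis unfolding \<alpha>_def using mn by (intro powr_mono2') auto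
  qed
  have \<alpha>_pow: "1 / \<alpha> j ^ (n - 1) = \<phi> (c * real j)" if "j \<ge> 1" for j
  proof -
    have pos: "\<phi> (c * real j) > 0" using that c by (intro \<phi>_pos) auto
    have "\<alpha> j ^ (n - 1) = \<phi> (c * real j) powr (- (1 / (real n - 1)) * real (n - 1))"
      using pos by (simp add: \<alpha>_def powr_powr flip: powr_realpow)
    also have "- (1 / (real n - 1)) * real (n - 1) = - 1" using mn by (simp add: of_nat_diff)
    finally show ?thesis using pos by (simp add: powr_minus_divide)
  qed
  have "summable (\<lambda>j. real j powr q * h (c * real j))"
  proof (rule summable_of_nn_integral_antimono)
    show "h t \<le> h s" if "0 < s" "s \<le> t" for s t
      unfolding h_def using that \<phi>_pos[of s] \<phi>_pos[of t] \<phi>_mono[of s t] mn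
      by (intro divide_left_mono powr_mono2) auto
    show "(\<integral>\<^sup>+s\<in>{1..}. ennreal (s powr q * h s) \<partial>lebesgue) < \<infinity>"
      using c1 by (simp add: h_def q_def m_def n_def)
  qed (use c q in \<open>auto simp: h_def\<close>)
  moreover have "(real j * \<alpha> j) powr q = real j powr q * h (c * real j)" for j
  proof (cases "j = 0")
    case False
    have "\<alpha> j powr q = \<phi> (c * real j) powr (- (1 / (real n - 1)) * q)"
      by (simp add: \<alpha>_def powr_powr)
    also have "- (1 / (real n - 1)) * q = - (1 / (real m - 1))"
      using mn by (simp add: q_def field_simps)
    finally show ?thesis
      by (simp add: powr_mult h_def powr_minus_divide)
  qed (use q in simp)
  ultimately have "summable (\<lambda>j. (real j * \<alpha> j) powr q)" by simp
  from summable_powr_tails[OF q \<alpha>_pos \<alpha>_anti this]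
  have sum\<alpha>: "summable \<alpha>" and sumS: "summable (\<lambda>t. S t powr q)"
    by (simp_all add: S_def)
  have sum\<alpha>t: "summable (\<lambda>i. \<alpha> (t + i))" for t
    using sum\<alpha> by (simp add: add.commute summable_iff_shift)
  have S_pos: "S t > 0" if "t \<ge> 1" for t
    unfolding S_def using that \<alpha>_pos sum\<alpha>t by (intro suminf_pos) auto
  have S_le: "(\<Sum>i<k. \<alpha> (t + i)) \<le> S t" if "t \<ge> 1" for t k
    unfolding S_def using that \<alpha>_pos sum\<alpha>t by (intro sum_le_suminf) (auto intro: less_imp_le)

  obtain x0 y0 where xy: "z = (x0, y0)" by (cases z)
  have mem: "(x0, y0) \<in> \<Omega>" using z xy by simp
  obtain R where R: "R > 0" "cball x0 R \<times> cball y0 R \<subseteq> \<Omega>"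
    using open_contains_prod_cball[OF \<open>open \<Omega>\<close> mem] .
  define \<rho> where "\<rho> = R / 2"
  have \<rho>: "\<rho> > 0" using R by (simp add: \<rho>_def)
  have subx: "cball x \<rho> \<subseteq> cball x0 R" if "x \<in> cball x0 \<rho>" for x
  proof
    fix x' assume "x' \<in> cball x \<rho>"
    then show "x' \<in> cball x0 R" using that dist_triangle[of x0 x' x] by (simp add: \<rho>_def)
  qed
  have suby: "cball y \<rho> \<subseteq> cball y0 R" if "y \<in> cball y0 \<rho>" for y
  proof
    fix y' assume "y' \<in> cball y \<rho>"
    then show "y' \<in> cball y0 R" using that dist_triangle[of y0 y' y] by (simp add: \<rho>_def)
  qed
  let ?K = "cball x0 R \<times> cball y0 R"
  define f where "f z = \<phi> (log_plus (real_of_ereal (max (u z) 0) powr p))" for z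
  have f0: "f z \<ge> 0" for z
    unfolding f_def using \<phi>_mono[of 0] \<phi>0 by (simp add: log_plus_def)
  define F where "F z = ennreal (indicator ?K z *\<^sub>R f z)" for z
  have "set_integrable lebesgue ?K f"
    using c2[unfolded locally_integrable_on_def, rule_format, OF compact_Times[OF compact_cball compact_cball] R(2)]
    by (simp add: f_def[abs_def])
  then have intf: "integrable lebesgue (\<lambda>z. indicator ?K z *\<^sub>R f z)"
    by (simp add: set_integrable_def)
  then have "F \<in> borel_measurable lebesgue"
    unfolding F_def by (intro measurable_compose[OF _ measurable_ennreal]) auto
  \<comment> \<open>a Borel version of the integrand, so that Tonelli's theorem applies on the product\<close>
  then obtain g where g: "g \<in> borel_measurable lborel" and Fg: "AE z in lborel. F z = g z"
    using completion_ex_borel_measurable by blast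
  define I where "I = (LINT z|lebesgue. indicator ?K z *\<^sub>R f z)"
  have I: "0 \<le> I" unfolding I_def using f0 by (intro integral_nonneg_AE) auto
  have g_int: "(\<integral>\<^sup>+z. g z \<partial>lborel) = ennreal I"
  proof -
    have "(\<integral>\<^sup>+z. g z \<partial>lborel) = (\<integral>\<^sup>+z. F z \<partial>lborel)"
      using Fg by (intro nn_integral_cong_AE) auto
    also have "\<dots> = (\<integral>\<^sup>+z. F z \<partial>lebesgue)" by (simp add: nn_integral_completion)
    also have "\<dots> = ennreal I"
      unfolding F_def I_def using intf f0 by (intro nn_integral_eq_integral) auto
    finally show ?thesis .
  qed
  have g'[measurable]: "g \<in> borel_measurable (lborel \<Otimes>\<^sub>M lborel)"
    using g by (simp only: lborel_prod)
  define G where "G x = (\<integral>\<^sup>+y. g (x, y) \<partial>lborel)" for x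
  have G_meas: "G \<in> borel_measurable borel"
  proof -
    have "(\<lambda>x. \<integral>\<^sup>+y. g (x, y) \<partial>lborel) \<in> borel_measurable lborel" by measurable
    then show ?thesis by (simp add: G_def[abs_def])
  qed
  have G_int: "(\<integral>\<^sup>+x. G x \<partial>lborel) = ennreal I"
    unfolding G_def using lborel.nn_integral_fst[OF g'] g_int by (simp only: lborel_prod)
  have Fg': "AE x in lborel. AE y in lborel. F (x, y) = g (x, y)"
    using Fg by (intro lborel_pair.AE_pair) (simp only: lborel_prod)

  define \<kappa> where "\<kappa> = real n * unit_ball_vol (real n) * \<rho> ^ n / (6 * 2 ^ n)"
  have \<kappa>: "\<kappa> > 0" using mn \<rho> by (simp add: \<kappa>_def)
  have step1: "AE x in lborel. x \<in> cball x0 R \<longrightarrow> (\<forall>y\<in>cball y0 \<rho>. \<forall>t\<ge>1. ereal (2 ^ (t + 1)) \<le> u (x, y)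
      \<longrightarrow> ennreal (\<kappa> / S t ^ (n - 1)) \<le> G x)"
    using Fg'
  proof eventually_elim
    case (elim x)
    show ?case
    proof (intro impI ballI allI)
      fix y and t :: nat
      assume x: "x \<in> cball x0 R" and y: "y \<in> cball y0 \<rho>" and t: "t \<ge> 1"
        and large: "ereal (2 ^ (t + 1)) \<le> u (x, y)"
      show "ennreal (\<kappa> / S t ^ (n - 1)) \<le> G x"
      proof (rule ccontr)
        assume "\<not> ?thesis"
        then have less: "G x < ennreal (\<kappa> / S t ^ (n - 1))" by simp
        then obtain I' where I': "G x = ennreal I'" "0 \<le> I'" by (cases "G x") auto
        with less have I'_less: "I' < \<kappa> / S t ^ (n - 1)" by (simp add: ennreal_less_iff)
        have sub: "cball y \<rho> \<subseteq> {y. (x, y) \<in> \<Omega>}" using suby[OF y] x R(2) by blast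
        have "u (x, y) < ereal (2 ^ (t + 1))"
        proof (rule subharmonic_domar_bound[OF b[rule_format, of x] sub \<rho>, where a = "\<lambda>i. \<alpha> (t + i)" and S = "S t"
              and H = "\<lambda>y. g (x, y)" and I = I'])
          show "(\<lambda>y. g (x, y)) \<in> borel_measurable borel"
            using measurable_Pair2[OF g', of x] by simp
          show "(\<integral>\<^sup>+y\<in>cball y \<rho>. g (x, y) \<partial>lborel) \<le> ennreal I'"
            unfolding I'(1)[symmetric] G_def by (intro nn_integral_mono) (simp add: indicator_def)
          show "AE y' in lborel. \<forall>i. y' \<in> cball y \<rho> \<longrightarrow> ereal (2 ^ (t + i)) \<le> u (x, y')
              \<longrightarrow> ennreal (1 / \<alpha> (t + i) ^ (DIM('b) - 1)) \<le> g (x, y')"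
            using elim
          proof eventually_elim
            case (elim y')
            show ?case
            proof (intro allI impI)
              fix i assume y': "y' \<in> cball y \<rho>" and le: "ereal (2 ^ (t + i)) \<le> u (x, y')"
              have K: "(x, y') \<in> ?K" using suby[OF y] y' x by blast
              have "c * real (t + i) \<le> log_plus (real_of_ereal (max (u (x, y')) 0) powr p)"
                unfolding c_def by (rule log_plus_powr_ge[OF le]) (use K R(2) fin \<open>p > 0\<close> in blast)+
              then have "\<phi> (c * real (t + i)) \<le> f (x, y')"
                unfolding f_def using c by (intro \<phi>_mono) auto
              then have "ennreal (1 / \<alpha> (t + i) ^ (n - 1)) \<le> ennreal (f (x, y'))"
                using \<alpha>_pow[of "t + i"] t by (simp add: ennreal_leI)
              also have "\<dots> = F (x, y')" using K by (simp add: F_def)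
              finally show "ennreal (1 / \<alpha> (t + i) ^ (DIM('b) - 1)) \<le> g (x, y')"
                using elim by (simp add: n_def)
            qed
          qed
          have "6 * 2 ^ n * I' * S t ^ (n - 1) \<le> real n * unit_ball_vol (real n) * \<rho> ^ n"
            using I'_less S_pos[OF t] by (simp add: \<kappa>_def field_simps)
          then show "6 * 2 ^ DIM('b) * I' * S t ^ (DIM('b) - 1) \<le> real DIM('b) * unit_ball_vol (real DIM('b)) * \<rho> ^ DIM('b)"
            by (simp add: n_def)
        qed (use \<alpha>_pos S_le t I' in auto)
        with large show False by simp
      qed
    qed
  qed

  define \<kappa>' where "\<kappa>' = (1 / \<kappa>) powr (1 / (real m - 1))"
  have \<kappa>': "\<kappa>' > 0" using \<kappa> by (simp add: \<kappa>'_def)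
  define C where "C = real m * unit_ball_vol (real m) * \<rho> ^ m"
  have C: "C > 0" using mn \<rho> by (simp add: C_def)
  \<comment> \<open>\<open>e \<le> 1\<close> gives \<open>e^(m-1) \<le> e\<close>, so a bound linear in \<open>e\<close> suffices\<close>
  define e where "e = min 1 (C / (6 * 2 ^ m * I + 1))"
  have e: "e > 0" "e \<le> 1" using C I by (auto simp: e_def add_nonneg_pos)
  have e_small: "6 * 2 ^ m * I * e ^ (m - 1) \<le> C"
  proof -
    have "e ^ (m - 1) \<le> e ^ 1" using e mn by (intro power_decreasing) auto
    then have "6 * 2 ^ m * I * e ^ (m - 1) \<le> 6 * 2 ^ m * I * e"
      using I by (intro mult_left_mono) auto
    also have "\<dots> \<le> (6 * 2 ^ m * I + 1) * e" using e by (simp add: algebra_simps)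
    also have "\<dots> \<le> (6 * 2 ^ m * I + 1) * (C / (6 * 2 ^ m * I + 1))"
      using I by (intro mult_left_mono) (auto simp: e_def)
    also have "\<dots> = C" using I by (simp add: add_nonneg_eq_0_iff)
    finally show ?thesis .
  qed
  obtain T0 where T0: "\<And>T. T \<ge> T0 \<Longrightarrow> norm (\<Sum>i. S (i + T) powr q) < e / \<kappa>'"
    using suminf_exist_split[OF _ sumS, of "e / \<kappa>'"] e \<kappa>' by auto
  \<comment> \<open>\<open>T \<ge> 1\<close> because \<open>S\<^sub>0\<close> would involve \<open>\<phi> 0 = 0\<close>\<close>
  define T where "T = max 1 T0"
  have T: "T \<ge> 1" "T \<ge> T0" by (auto simp: T_def)
  define \<beta> where "\<beta> i = \<kappa>' * S (T + i) powr q" for i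
  have sumST: "summable (\<lambda>i. S (T + i) powr q)"
    using sumS summable_iff_shift[of "\<lambda>t. S t powr q" T] by (simp add: add.commute)
  have \<beta>_pos: "\<beta> i > 0" for i using \<kappa>' S_pos[of "T + i"] T by (simp add: \<beta>_def)
  have \<beta>_sum: "(\<Sum>i<k. \<beta> i) \<le> e" for k
  proof -
    have "(\<Sum>i<k. \<beta> i) = \<kappa>' * (\<Sum>i<k. S (T + i) powr q)" by (simp add: \<beta>_def sum_distrib_left)
    also have "\<dots> \<le> \<kappa>' * (\<Sum>i. S (T + i) powr q)"
      using \<kappa>' sumST by (intro mult_left_mono sum_le_suminf) auto
    also have "\<dots> \<le> \<kappa>' * (e / \<kappa>')"
      using T0[OF T(2)] \<kappa>' by (intro mult_left_mono) (auto simp: add.commute)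
    finally show ?thesis using \<kappa>' by simp
  qed
  have \<beta>_pow: "1 / \<beta> i ^ (m - 1) = \<kappa> / S (T + i) ^ (n - 1)" for i
  proof -
    have Sp: "S (T + i) > 0" using S_pos T by simp
    have "\<kappa>' ^ (m - 1) = (1 / \<kappa>) powr (1 / (real m - 1) * real (m - 1))"
      using \<kappa>' \<kappa> by (simp add: \<kappa>'_def powr_powr flip: powr_realpow)
    also have "1 / (real m - 1) * real (m - 1) = 1" using mn by (simp add: of_nat_diff)
    finally have 1: "\<kappa>' ^ (m - 1) = 1 / \<kappa>" using \<kappa> by simp
    have "(S (T + i) powr q) ^ (m - 1) = S (T + i) powr (q * real (m - 1))"
      using Sp by (simp add: powr_powr flip: powr_realpow)
    also have "q * real (m - 1) = real (n - 1)" using mn by (simp add: q_def of_nat_diff)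
    also have "S (T + i) powr real (n - 1) = S (T + i) ^ (n - 1)" using Sp by (rule powr_realpow)
    finally show ?thesis using 1 by (simp add: \<beta>_def power_mult_distrib)
  qed
  have "u (x, y) < ereal (2 ^ (T + 1 + 1))" if x: "x \<in> cball x0 \<rho>" and y: "y \<in> cball y0 \<rho>" for x y
  proof -
    have yR: "y \<in> cball y0 R" using y \<rho> by (simp add: \<rho>_def)
    have sub: "cball x \<rho> \<subseteq> {x. (x, y) \<in> \<Omega>}" using subx[OF x] yR R(2) by blast
    \<comment> \<open>starting level \<open>T + 1\<close>: the level \<open>T + 1 + i\<close> of \<open>u\<close> belongs to \<open>S (T + i)\<close>\<close>
    show ?thesis
    proof (rule subharmonic_domar_bound[OF a[rule_format, of y] sub \<rho> \<beta>_pos \<beta>_sum G_meas _ I])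
      show "(\<integral>\<^sup>+x\<in>cball x \<rho>. G x \<partial>lborel) \<le> ennreal I"
        unfolding G_int[symmetric] by (intro nn_integral_mono) (simp add: indicator_def)
      show "AE x' in lborel. \<forall>i. x' \<in> cball x \<rho> \<longrightarrow> ereal (2 ^ (T + 1 + i)) \<le> u (x', y)
          \<longrightarrow> ennreal (1 / \<beta> i ^ (DIM('a) - 1)) \<le> G x'"
        using step1
      proof eventually_elim
        case (elim x')
        show ?case
        proof (intro allI impI)
          fix i assume x': "x' \<in> cball x \<rho>" and le: "ereal (2 ^ (T + 1 + i)) \<le> u (x', y)"
          have "x' \<in> cball x0 R" using subx[OF x] x' by blast
          moreover have "ereal (2 ^ (T + i + 1)) \<le> u (x', y)" using le by (simp add: add_ac)
          ultimately have "ennreal (\<kappa> / S (T + i) ^ (n - 1)) \<le> G x'"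
            using elim y T by (meson trans_le_add1)
          then show "ennreal (1 / \<beta> i ^ (DIM('a) - 1)) \<le> G x'"
            using \<beta>_pow[of i] by (simp add: m_def)
        qed
      qed
      show "6 * 2 ^ DIM('a) * I * e ^ (DIM('a) - 1) \<le> real DIM('a) * unit_ball_vol (real DIM('a)) * \<rho> ^ DIM('a)"
        using e_small by (simp add: C_def m_def)
    qed
  qed
  note bound = this
  show ?thesis
  proof (intro exI conjI)
    show "open (ball x0 \<rho> \<times> ball y0 \<rho>)" by (intro open_Times) auto
    show "z \<in> ball x0 \<rho> \<times> ball y0 \<rho>" using xy \<rho> by simp
    have "ball x0 \<rho> \<times> ball y0 \<rho> \<subseteq> cball x0 R \<times> cball y0 R"
      using \<rho> by (auto simp: \<rho>_def)
    then show "ball x0 \<rho> \<times> ball y0 \<rho> \<subseteq> \<Omega>" using R(2) by blast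
    show "\<forall>w\<in>ball x0 \<rho> \<times> ball y0 \<rho>. u w \<le> ereal (2 ^ (T + 1 + 1))"
      using bound by (fastforce intro: less_imp_le)
  qed
qed

theorem corollary4p7:
  fixes \<Omega> :: "((real^'m) \<times> (real^'n)) set"
    and u :: "(real^'m) \<times> (real^'n) \<Rightarrow> ereal"
    and \<phi> :: "real \<Rightarrow> real"
    and r :: real
  assumes "CARD('n) \<ge> 2" and "CARD('m) \<ge> CARD('n)"
    and "open \<Omega>" and "connected \<Omega>" and "\<Omega> \<noteq> {}"
    and "\<forall>z\<in>\<Omega>. u z < \<infinity>"
    and a: "\<forall>y. subharmonic_on {x. (x, y) \<in> \<Omega>} (\<lambda>x. u (x, y))"
    and b: "\<forall>x. subharmonic_on {y. (x, y) \<in> \<Omega>} (\<lambda>y. u (x, y))"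
    and "strict_mono_on {0..} \<phi>" and "\<phi> ` {0..} = {0..}"
    and c1: "(\<integral>\<^sup>+s\<in>{1..}. ennreal (s powr ((real CARD('n) - 1) / (real CARD('m) - 1))
               / \<phi> s powr (1 / (real CARD('m) - 1))) \<partial>lebesgue) < \<infinity>"
    and "r > 0"
    and c2: "locally_integrable_on
               (\<lambda>z. \<phi> (log_plus (real_of_ereal (max (u z) 0) powr r))) \<Omega>"
  shows "subharmonic_on \<Omega> u"
proof (rule separately_subharmonic_imp_subharmonic[OF \<open>open \<Omega>\<close> _ a b])
  show "\<exists>W M. open W \<and> z \<in> W \<and> W \<subseteq> \<Omega> \<and> (\<forall>w\<in>W. u w \<le> ereal M)" if "z \<in> \<Omega>" for z
    by (rule separately_subharmonic_locally_bounded[OF _ _ \<open>open \<Omega>\<close> _ a b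
          \<open>strict_mono_on {0..} \<phi>\<close> \<open>\<phi> ` {0..} = {0..}\<close> _ \<open>r > 0\<close> c2 that])
       (use assms in \<open>simp_all\<close>)
qed (use assms in auto)

end
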